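(* Let $B\subset\mathbb{R}^3$ be the unit ball centered at the origin, let $k>0$, and let $(\mathcal{K}_B^k)^*$ be the Neumann-Poincaré operator of $B$ for the Helmholtz operator $\Delta+k^2$. Then for all integers $n\ge 0$ and $-n\le m\le n$, $$(\mathcal{K}_B^k)^*[Y_n^m]=\Big(-\frac12-ik^2 j_n(k)\,{h_n^{(1)}}'(k)\Big)Y_n^m=\Big(\frac12-ik^2 j_n'(k)\,h_n^{(1)}(k)\Big)Y_n^m .$$
   Context: For $k>0$ put $G_k(\mathbf{x})=-\dfrac{e^{ik|\mathbf{x}|}}{4\pi|\mathbf{x}|}$, $\mathbf{x}\in\mathbb{R}^3\setminus\{0\}$. The Neumann-Poincaré operator $(\mathcal{K}_B^k)^*:H^{-1/2}(\partial B)\to H^{-1/2}(\partial B)$ is $$(\mathcal{K}_B^k)^*[\phi](\mathbf{x})=\mathrm{p.v.}\int_{\partial B}\frac{\partial G_k(\mathbf{x}-\mathbf{y})}{\partial\nu_{\mathbf{x}}}\,\phi(\mathbf{y})\,ds_{\mathbf{y}},\qquad \mathbf{x}\in\partial B,$$ where $\nu$ is the exterior unit normal to $\partial B$, the normal derivative is taken in $\mathbf{x}$, and p.v. denotes the Cauchy principal value. $Y_n^m$ are the spherical harmonics of order $n$ and degree $m$ on $\partial B=\mathbb{S}^2$. $j_n$ and $y_n$ are the standard spherical Bessel and spherical Neumann functions of order $n$, and $h_n^{(1)}=j_n+iy_n$ is the spherical Hankel function of the first kind; they satisfy the Wronskian identity $j_n'(t)h_n^{(1)}(t)-j_n(t){h_n^{(1)}}'(t)=-i/t^2$.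 *)

theory Defs
  imports "HOL-Analysis.Analysis" "HOL-Computational_Algebra.Polynomial"
begin

text \<open>The Bessel functions below are used for positive real argument only. The reciprocal
  Gamma function vanishes at the poles of Gamma, so the series is the usual one for every order.\<close>

definition bessel_J :: "real \<Rightarrow> real \<Rightarrow> real" where
  "bessel_J \<nu> t =
     (\<Sum>l. (-1) ^ l * rGamma (\<nu> + real l + 1) / fact l * (t / 2) powr (\<nu> + 2 * real l))"

text \<open>For integer \<open>\<nu>\<close> this quotient is not the Neumann function (a limit in \<open>\<nu>\<close>
  would be needed); only half-integer orders occur.\<close>

definition bessel_Y :: "real \<Rightarrow> real \<Rightarrow> real" where
  "bessel_Y \<nu> t = (cos (\<nu> * pi) * bessel_J \<nu> t - bessel_J (-\<nu>) t) / sin (\<nu> * pi)"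

definition sph_bessel_j :: "nat \<Rightarrow> real \<Rightarrow> real" where
  "sph_bessel_j n t = sqrt (pi / (2 * t)) * bessel_J (real n + 1 / 2) t"

definition sph_bessel_y :: "nat \<Rightarrow> real \<Rightarrow> real" where
  "sph_bessel_y n t = sqrt (pi / (2 * t)) * bessel_Y (real n + 1 / 2) t"

definition sph_hankel1 :: "nat \<Rightarrow> real \<Rightarrow> complex" where
  "sph_hankel1 n t = complex_of_real (sph_bessel_j n t) + \<i> * complex_of_real (sph_bessel_y n t)"

text \<open>Rodrigues' formula.\<close>

definition legendre_poly :: "nat \<Rightarrow> real poly" where
  "legendre_poly n = smult (1 / (2 ^ n * fact n)) ((pderiv ^^ n) ([:-1, 0, 1:] ^ n))"

text \<open>The Condon--Shortley phase is part of the associated Legendre function.\<close>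

definition assoc_legendre :: "nat \<Rightarrow> nat \<Rightarrow> real \<Rightarrow> real" where
  "assoc_legendre n m s =
     (-1) ^ m * sqrt (1 - s\<^sup>2) ^ m * poly ((pderiv ^^ m) (legendre_poly n)) s"

text \<open>Spherical harmonics in the angles \<open>\<theta>\<close> (polar) and \<open>\<phi>\<close> (azimuthal),
  orthonormal in \<open>L\<^sup>2\<close> of the unit sphere. For \<open>m < 0\<close> the usual convention
  \<open>Y\<^sub>n\<^sup>m = (-1)\<^sup>m cnj Y\<^sub>n\<^sup>-\<^sup>m\<close> is used.\<close>

definition sph_harmonic_angles :: "nat \<Rightarrow> int \<Rightarrow> real \<Rightarrow> real \<Rightarrow> complex" where
  "sph_harmonic_angles n m \<theta> \<phi> =
     (let a = nat \<bar>m\<bar> in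
      (if m < 0 then (-1) ^ a else 1) *
      complex_of_real (sqrt ((2 * real n + 1) / (4 * pi) * (fact (n - a) / fact (n + a)))
                       * assoc_legendre n a (cos \<theta>)) *
      cis (of_int m * \<phi>))"

text \<open>At the poles, where the azimuth is undetermined, \<open>Arg 0 = 0\<close>; the choice is
  immaterial because the associated Legendre factor vanishes there unless \<open>m = 0\<close>.\<close>

definition sph_harmonic :: "nat \<Rightarrow> int \<Rightarrow> real^3 \<Rightarrow> complex" where
  "sph_harmonic n m x = sph_harmonic_angles n m (arccos (x $ 3)) (Arg (Complex (x $ 1) (x $ 2)))"

definition sphere_param :: "real \<times> real \<Rightarrow> real^3" where
  "sphere_param = (\<lambda>(\<theta>, \<phi>). vector [sin \<theta> * cos \<phi>, sin \<theta> * sin \<phi>, cos \<theta>])"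

text \<open>Push-forward of the area element \<open>sin \<theta> d\<theta> d\<phi>\<close>, where \<open>sin \<theta>\<close> is the norm of
  the cross product of the partial derivatives of the parametrisation. As a measure on the whole
  space it is concentrated on \<open>sphere 0 1\<close>.\<close>

definition sphere_measure :: "(real^3) measure" where
  "sphere_measure =
     distr (density lborel (\<lambda>(\<theta>, \<phi>). ennreal (indicator ({0..pi} \<times> {0..2 * pi}) (\<theta>, \<phi>) * sin \<theta>)))
           borel sphere_param"

text \<open>Cauchy principal value at \<open>x\<close>: the truncated integrals exist as Lebesgue integrals and
  converge as the excised ball shrinks.\<close>

definition has_sphere_pv :: "(real^3 \<Rightarrow> complex) \<Rightarrow> real^3 \<Rightarrow> complex \<Rightarrow> bool" where
  "has_sphere_pv f x I \<longleftrightarrow>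
     (\<forall>\<epsilon>>0. set_integrable sphere_measure (sphere 0 1 - ball x \<epsilon>) f) \<and>
     ((\<lambda>\<epsilon>. set_lebesgue_integral sphere_measure (sphere 0 1 - ball x \<epsilon>) f) \<longlongrightarrow> I) (at_right 0)"

definition sphere_pv_exists :: "(real^3 \<Rightarrow> complex) \<Rightarrow> real^3 \<Rightarrow> bool" where
  "sphere_pv_exists f x \<longleftrightarrow> (\<exists>I. has_sphere_pv f x I)"

definition sphere_pv :: "(real^3 \<Rightarrow> complex) \<Rightarrow> real^3 \<Rightarrow> complex" where
  "sphere_pv f x = (THE I. has_sphere_pv f x I)"

definition helmholtz_G :: "real \<Rightarrow> real^3 \<Rightarrow> complex" where
  "helmholtz_G k x = - exp (\<i> * complex_of_real (k * norm x)) / complex_of_real (4 * pi * norm x)"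

text \<open>Exterior unit normal of \<open>ball 0 1\<close> at a point of \<open>sphere 0 1\<close>.\<close>

definition unit_ball_normal :: "real^3 \<Rightarrow> real^3" where
  "unit_ball_normal x = x"

text \<open>Normal derivative in \<open>x\<close> of \<open>G\<^sub>k (x - y)\<close>; meaningful for \<open>x \<noteq> y\<close>.\<close>

definition np_kernel :: "real \<Rightarrow> real^3 \<Rightarrow> real^3 \<Rightarrow> complex" where
  "np_kernel k x y =
     frechet_derivative (\<lambda>z. helmholtz_G k (z - y)) (at x) (unit_ball_normal x)"

definition np_defined_at :: "real \<Rightarrow> (real^3 \<Rightarrow> complex) \<Rightarrow> real^3 \<Rightarrow> bool" where
  "np_defined_at k f x \<longleftrightarrow> sphere_pv_exists (\<lambda>y. np_kernel k x y * f y) x"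

definition np_operator :: "real \<Rightarrow> (real^3 \<Rightarrow> complex) \<Rightarrow> real^3 \<Rightarrow> complex" where
  "np_operator k f x = sphere_pv (\<lambda>y. np_kernel k x y * f y) x"

end

theory Submission
  imports Defs
begin

text \<open>For \<open>x\<close>, \<open>y\<close> on the unit sphere the kernel only depends on \<open>r = \<bar>x - y\<bar>\<close> and equals
  \<open>(1 - \<i>kr) e\<^bsup>\<i>kr\<^esup> / (8\<pi>r)\<close>. The surface measure is rotation invariant, because cones over a set and
  over its rotated copy have the same volume, so one may integrate in spherical coordinates with
  pole \<open>x\<close>. The mean of \<open>Y\<^sub>n\<^sup>m\<close> over the circle at polar angle \<open>\<theta>\<close> around \<open>x\<close> is
  \<open>P\<^sub>n (cos \<theta>) Y\<^sub>n\<^sup>m(x)\<close>: the spherical harmonics of order \<open>n\<close> are the coefficients of the \<open>n\<close>-th powers of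
  linear forms with isotropic coefficient vector, and for these powers the claim is Laplace's
  integral for \<open>P\<^sub>n\<close>. With \<open>r = 2 sin (\<theta>/2)\<close> the eigenvalue becomes
  \<open>(A - k A') / 4\<close>, where \<open>A(k)\<close> is the integral of \<open>e\<^bsup>\<i>kr\<^esup> P\<^sub>n(1 - r\<^sup>2/2)\<close> over \<open>[0, 2]\<close>.
  Finally \<open>A = 2 \<i> k j\<^sub>n(k) h\<^sub>n(k)\<close>, since both sides obey the same recursion in \<open>n\<close>, and the Wronskian gives the
  two forms of the eigenvalue.\<close>

section \<open>Legendre polynomials\<close>

text \<open>The eigenvalue comes straight from the kernel, without layer potentials or an addition
  theorem. In the variable \<open>r\<close> the area element \<open>sin \<theta> d\<theta>\<close>
  is \<open>r dr\<close>, which cancels the factor \<open>1/r\<close> of the kernel, so the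
  principal value is only a limit of integrals of a continuous function over
  \<open>[\<epsilon>, 2]\<close>. The combination \<open>A - k A'\<close> appears because
  \<open>(1 - \<i>kr) e^(\<i>kr)\<close> is \<open>e^(\<i>kr)\<close> minus \<open>k\<close> times
  its derivative in \<open>k\<close>. The obstacle is that two definitions single out an axis: the
  measure is a push-forward from angles, and the harmonics are written in angles. Hence the detours
  through volume and through a generating polynomial. A rotation turns a linear form with isotropic
  coefficients into another one, so Laplace's integral holds for every value of the generating
  parameter, and comparing coefficients treats all \<open>m\<close> at once, without rotation
  matrices for the harmonics. The recursion for \<open>A\<close> relates derivatives of neighbouring
  members, so each step in \<open>n\<close> is a first-order differential equation in
  \<open>k\<close> whose constant has to be fixed by the behaviour at 0.\<close>

lemma pderiv_funpow_X_mult: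
  fixes p :: "real poly"
  shows "(pderiv ^^ Suc n) ([:0, 1:] * p)
    = [:0, 1:] * (pderiv ^^ Suc n) p + smult (real (Suc n)) ((pderiv ^^ n) p)"
proof (induction n)
  case 0
  show ?case by (simp add: pderiv_mult pderiv_pCons algebra_simps)
next
  case (Suc n)
  have "(pderiv ^^ Suc (Suc n)) ([:0, 1:] * p) = pderiv ((pderiv ^^ Suc n) ([:0, 1:] * p))"
    by simp
  also have "\<dots> = [:0, 1:] * (pderiv ^^ Suc (Suc n)) p + smult (of_nat (Suc (Suc n))) ((pderiv ^^ Suc n) p)"
    unfolding Suc.IH pderiv_add pderiv_mult pderiv_smult
    by (intro poly_eq_poly_eq_iff[THEN iffD1] ext) (simp add: pderiv_pCons algebra_simps)
  finally show ?case .
qed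

lemma pderiv_funpow_smult: "(pderiv ^^ n) (smult c p) = smult c ((pderiv ^^ n) (p::real poly))"
  by (induction n) (simp_all add: pderiv_smult)

lemma pderiv_funpow_diff: "(pderiv ^^ n) (p - q) = (pderiv ^^ n) p - (pderiv ^^ n) (q::real poly)"
  by (induction n) (simp_all add: pderiv_diff)

lemma pderiv_rodrigues_base:
  "pderiv ([:-1, 0, 1:] ^ Suc n) = smult (2 * real (Suc n)) ([:0, 1:] * [:-1, 0, 1:] ^ n)"
  unfolding pderiv_power_Suc
  by (intro poly_eq_poly_eq_iff[THEN iffD1] ext) (simp add: pderiv_pCons algebra_simps)

text \<open>One derivative of \<open>(X^2 - 1)^(n+1)\<close> leaves
  \<open>2 (n+1) X (X^2 - 1)^n\<close>; for the remaining ones Leibniz's rule stops after two terms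
  because the second derivative of \<open>X\<close> is 0.\<close>

lemma pderiv_legendre_Suc:
  "pderiv (legendre_poly (Suc n))
     = [:0, 1:] * pderiv (legendre_poly n) + smult (real (Suc n)) (legendre_poly n)"
proof -
  let ?R = "[:-1, 0, 1:] :: real poly"
  have "(pderiv ^^ Suc (Suc n)) (?R ^ Suc n) = (pderiv ^^ Suc n) (pderiv (?R ^ Suc n))"
    by (simp only: funpow_Suc_right o_apply)
  also have "\<dots> = smult (2 * real (Suc n)) ([:0, 1:] * (pderiv ^^ Suc n) (?R ^ n)
      + smult (real (Suc n)) ((pderiv ^^ n) (?R ^ n)))"
    unfolding pderiv_rodrigues_base pderiv_funpow_smult pderiv_funpow_X_mult ..
  finally have "smult (1 / (2 ^ Suc n * fact (Suc n))) ((pderiv ^^ Suc (Suc n)) (?R ^ Suc n)) =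
    smult (1 / (2 ^ n * fact n)) ([:0, 1:] * (pderiv ^^ Suc n) (?R ^ n)
      + smult (real (Suc n)) ((pderiv ^^ n) (?R ^ n)))"
    by (simp del: of_nat_Suc funpow.simps power_Suc add: field_simps)
       (simp add: field_simps del: funpow.simps)
  then show ?thesis
    by (simp add: legendre_poly_def pderiv_smult smult_add_right mult.commute)
qed

text \<open>The same derivative of \<open>(X^2 - 1)^(n+1)\<close> is computed in two ways: by
  expanding \<open>X^2 * (X^2 - 1)^n - (X^2 - 1)^n\<close>, and by first differentiating the power
  once. Both contain the derivative \<open>u\<close> of order \<open>n - 1\<close>, which has to be
  eliminated; this is why \<open>n = 0\<close> is separate.\<close>

lemma legendre_Suc:
  "smult (real (Suc n)) (legendre_poly (Suc n))
     = smult (real (Suc n)) ([:0, 1:] * legendre_poly n) + [:-1, 0, 1:] * pderiv (legendre_poly n)"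
proof (cases n)
  case 0
  then show ?thesis by (simp add: legendre_poly_def pderiv_pCons)
next
  case (Suc l)
  let ?R = "[:-1, 0, 1:] :: real poly" and ?X = "[:0, 1:] :: real poly"
  define u where "u = (pderiv ^^ l) (?R ^ n)"
  have un: "(pderiv ^^ n) (?R ^ n) = pderiv u" "(pderiv ^^ Suc n) (?R ^ n) = pderiv (pderiv u)"
    unfolding u_def Suc by simp_all
  have 1: "(pderiv ^^ n) (?X * ?R ^ n) = ?X * pderiv u + smult (real n) u"
    using pderiv_funpow_X_mult[of l "?R ^ n"] unfolding Suc[symmetric] un u_def[symmetric] .
  have 2: "(pderiv ^^ Suc n) (?X * ?R ^ n) = ?X * pderiv (pderiv u) + smult (real (Suc n)) (pderiv u)"
    using pderiv_funpow_X_mult[of n "?R ^ n"] unfolding un .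
  have 3: "(pderiv ^^ Suc n) (?X * (?X * ?R ^ n)) = ?X * (pderiv ^^ Suc n) (?X * ?R ^ n)
       + smult (real (Suc n)) ((pderiv ^^ n) (?X * ?R ^ n))"
    by (rule pderiv_funpow_X_mult)
  have "?R ^ Suc n = ?X * (?X * ?R ^ n) - ?R ^ n" by (simp add: algebra_simps)
  then have Q1: "(pderiv ^^ Suc n) (?R ^ Suc n) = (pderiv ^^ Suc n) (?X * (?X * ?R ^ n)) - pderiv (pderiv u)"
    by (simp only: pderiv_funpow_diff un)
  have Q2: "(pderiv ^^ Suc n) (?R ^ Suc n) = smult (2 * real (Suc n)) ((pderiv ^^ n) (?X * ?R ^ n))"
    by (simp only: funpow_Suc_right o_apply pderiv_rodrigues_base pderiv_funpow_smult)
  \<comment> \<open>Twice the form \<open>Q1\<close> minus the form \<open>Q2\<close>: the terms in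
    \<open>u\<close> itself cancel.\<close>
  have "(pderiv ^^ Suc n) (?R ^ Suc n) = 2 * (pderiv ^^ Suc n) (?R ^ Suc n) - (pderiv ^^ Suc n) (?R ^ Suc n)"
    by simp
  also have "\<dots> = smult (2 * real (Suc n)) (?X * pderiv u) + smult 2 (?R * pderiv (pderiv u))"
    by (subst (1) Q1, subst Q2, unfold 1 2 3, intro poly_eq_poly_eq_iff[THEN iffD1] ext)
       (simp add: algebra_simps)
  finally have Q: "(pderiv ^^ Suc n) (?R ^ Suc n)
    = smult (2 * real (Suc n)) (?X * pderiv u) + smult 2 (?R * pderiv (pderiv u))" .
  have "smult (1 / (2 ^ Suc n * fact n)) ((pderiv ^^ Suc n) (?R ^ Suc n)) =
    smult (1 / (2 ^ n * fact n)) (smult (real (Suc n)) (?X * pderiv u) + ?R * pderiv (pderiv u))"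
    unfolding Q by (intro poly_eq_poly_eq_iff[THEN iffD1] ext) (simp add: field_simps)
  moreover have "smult (real (Suc n)) (legendre_poly (Suc n)) = smult (1 / (2 ^ Suc n * fact n)) ((pderiv ^^ Suc n) (?R ^ Suc n))"
    unfolding legendre_poly_def smult_smult by (simp del: funpow.simps power_Suc of_nat_Suc)
  ultimately show ?thesis
    unfolding legendre_poly_def un
    by (simp add: pderiv_smult smult_add_right mult.commute del: mult_pCons_left mult_pCons_right)
qed

lemma poly_pderiv_legendre_Suc:
  "poly (pderiv (legendre_poly (Suc n))) t
     = t * poly (pderiv (legendre_poly n)) t + real (Suc n) * poly (legendre_poly n) t"
  by (simp add: pderiv_legendre_Suc)

lemma poly_legendre_Suc:
  "real (Suc n) * poly (legendre_poly (Suc n)) t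
     = real (Suc n) * t * poly (legendre_poly n) t + (t\<^sup>2 - 1) * poly (pderiv (legendre_poly n)) t"
  using arg_cong[OF legendre_Suc[of n], of "\<lambda>p. poly p t"]
  by (simp add: algebra_simps power2_eq_square)

text \<open>Prepared for \<open>t = 1 - r^2/2\<close>, where \<open>t - 1\<close> is
  \<open>- r^2/2\<close>: it removes the derivatives of Legendre polynomials from the integration by
  parts over the chord length.\<close>

lemma poly_legendre_contiguous:
  "(t - 1) * (poly (pderiv (legendre_poly n)) t + poly (pderiv (legendre_poly (Suc n))) t)
     = real (Suc n) * (poly (legendre_poly (Suc n)) t - poly (legendre_poly n) t)"
  using poly_legendre_Suc[of n t] unfolding poly_pderiv_legendre_Suc
  by (simp add: algebra_simps power2_eq_square)

lemma poly_legendre_at_endpoint: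
  assumes "t\<^sup>2 = 1"
  shows "poly (legendre_poly n) t = t ^ n"
proof (induction n)
  case 0
  then show ?case by (simp add: legendre_poly_def)
next
  case (Suc n)
  have "real (Suc n) * poly (legendre_poly (Suc n)) t = real (Suc n) * (t * t ^ n)"
    using poly_legendre_Suc[of n t] assms Suc by simp
  then show ?case by (simp del: of_nat_Suc)
qed

section \<open>Spherical Bessel functions\<close>

text \<open>The Bessel-Clifford function of order \<nu> at \<open>-x\<close>, that is, the entire
  factor of \<open>bessel_J\<close>. Splitting off the power of \<open>t/2\<close> lets positive and
  negative orders be treated alike and gives a meaning at 0.\<close>

definition bessel_series :: "real \<Rightarrow> real \<Rightarrow> real" where
  "bessel_series \<nu> x = (\<Sum>l. (-1) ^ l * rGamma (\<nu> + real l + 1) / fact l * x ^ l)"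

lemma rGamma_step: "rGamma z = z * rGamma (z + 1 :: real)"
  by (rule rGamma_plus1[symmetric])

lemma summable_bessel_series: "summable (\<lambda>l. (-1) ^ l * rGamma (\<nu> + real l + 1) / fact l * x ^ l)"
\<comment> \<open>From this index on \<open>\<nu> + l + 1\<close> is at least 1 and
  \<open>l + 1\<close> at least \<open>2 * \<bar>x\<bar>\<close>, so the ratio
  \<open>\<bar>x\<bar> / ((\<nu> + l + 1) (l + 1))\<close> is at most 1/2.\<close>
proof (rule summable_ratio_test[where c = "1/2" and N = "nat \<lceil>\<bar>\<nu>\<bar> + 2 * \<bar>x\<bar> + 2\<rceil>"])
  fix l assume "nat \<lceil>\<bar>\<nu>\<bar> + 2 * \<bar>x\<bar> + 2\<rceil> \<le> l"
  then have l: "\<bar>\<nu>\<bar> + 2 * \<bar>x\<bar> + 2 \<le> real l" by linarith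
  define g where "g = rGamma (\<nu> + real (Suc l) + 1)"
  have r: "rGamma (\<nu> + real l + 1) = (\<nu> + real l + 1) * g"
    unfolding g_def by (subst rGamma_step) (simp add: algebra_simps)
  have 1: "1 \<le> \<nu> + real l + 1" and 2: "2 * \<bar>x\<bar> \<le> real (Suc l)" using l by auto
  have "\<bar>x\<bar> * 2 \<le> (\<nu> + real l + 1) * real (Suc l)"
    using mult_mono[OF 1 2] 1 by simp
  then have "\<bar>x\<bar> * 2 * (\<bar>g\<bar> * \<bar>x\<bar> ^ l) \<le> (\<nu> + real l + 1) * real (Suc l) * (\<bar>g\<bar> * \<bar>x\<bar> ^ l)"
    by (rule mult_right_mono) simp
  then show "norm ((-1) ^ Suc l * rGamma (\<nu> + real (Suc l) + 1) / fact (Suc l) * x ^ Suc l)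
      \<le> 1 / 2 * norm ((-1) ^ l * rGamma (\<nu> + real l + 1) / fact l * x ^ l)"
    unfolding r g_def[symmetric] using 1
    by (simp add: abs_mult power_abs[symmetric] divide_simps del: of_nat_Suc)
       (simp add: algebra_simps abs_mult power_abs)
qed simp

lemma diffs_bessel_series:
  "diffs (\<lambda>l. (-1) ^ l * rGamma (\<nu> + real l + 1) / fact l)
     = (\<lambda>l. - ((-1) ^ l * rGamma (\<nu> + 1 + real l + 1) / fact l))"
  by (rule ext) (simp add: diffs_def divide_simps add_ac del: of_nat_Suc, simp add: add_ac)

lemma bessel_series_deriv: "(bessel_series \<nu> has_field_derivative - bessel_series (\<nu> + 1) x) (at x)"
proof -
  have "((\<lambda>x. \<Sum>l. (-1) ^ l * rGamma (\<nu> + real l + 1) / fact l * x ^ l) has_field_derivative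
      (\<Sum>l. - ((-1) ^ l * rGamma (\<nu> + 1 + real l + 1) / fact l * x ^ l))) (at x)"
    using termdiffs_strong_converges_everywhere[OF summable_bessel_series, of \<nu> x]
    unfolding diffs_bessel_series by simp
  then show ?thesis
    unfolding suminf_minus[OF summable_bessel_series] bessel_series_def .
qed

text \<open>The right side is \<open>\<nu>\<close> plus the Euler operator \<open>x d/dx\<close>,
  applied to the series of order \<nu>. It multiplies the coefficient of \<open>x^l\<close> by
  \<open>\<nu> + l\<close>, which is exactly the shift of the reciprocal Gamma factor.\<close>

lemma bessel_series_contiguous: "bessel_series (\<nu> - 1) x = \<nu> * bessel_series \<nu> x - x * bessel_series (\<nu> + 1) x"
proof -
  let ?c = "\<lambda>l. (-1) ^ l * rGamma (\<nu> + real l + 1) / fact l"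
  have "summable (\<lambda>l. diffs ?c l * x ^ l)"
    unfolding diffs_bessel_series using summable_minus[OF summable_bessel_series[of "\<nu> + 1" x]] by simp
  from diffs_equiv[OF this]
  have "(\<lambda>l. real l * ?c l * x ^ (l - Suc 0)) sums (- bessel_series (\<nu> + 1) x)"
    unfolding diffs_bessel_series bessel_series_def
    using suminf_minus[OF summable_bessel_series[of "\<nu> + 1" x]] by simp
  from sums_add[OF sums_mult[OF summable_sums[OF summable_bessel_series[of \<nu> x]], of \<nu>] sums_mult[OF this, of x]]
  have "(\<lambda>l. \<nu> * (?c l * x ^ l) + x * (real l * ?c l * x ^ (l - Suc 0)))
      sums (\<nu> * bessel_series \<nu> x + x * - bessel_series (\<nu> + 1) x)"
    unfolding bessel_series_def .
  moreover have "\<nu> * (?c l * x ^ l) + x * (real l * ?c l * x ^ (l - Suc 0))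
      = (-1) ^ l * rGamma (\<nu> - 1 + real l + 1) / fact l * x ^ l" for l
  proof -
    have "rGamma (\<nu> + real l) = (\<nu> + real l) * rGamma (\<nu> + real l + 1)" by (rule rGamma_step)
    moreover have "x * (real l * ?c l * x ^ (l - Suc 0)) = real l * (?c l * x ^ l)"
      by (cases l) simp_all
    ultimately show ?thesis by (simp add: algebra_simps add_divide_distrib)
  qed
  ultimately show ?thesis
    unfolding bessel_series_def by (simp add: sums_unique[symmetric])
qed

lemma bessel_series_comp_deriv:
  "((\<lambda>t. bessel_series \<nu> (t\<^sup>2 / 4)) has_field_derivative - (t / 2) * bessel_series (\<nu> + 1) (t\<^sup>2 / 4)) (at t)"
  by (rule DERIV_chain2[OF bessel_series_deriv, THEN DERIV_cong])
     (auto intro!: derivative_eq_intros)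

lemma bessel_series_0: "bessel_series \<nu> 0 = rGamma (\<nu> + 1)"
  unfolding bessel_series_def by (subst suminf_finite[of "{0}"]) auto

text \<open>Both pairs solve the system \<open>c' = - s\<close>, \<open>s' = c\<close>, so the squared distance is constant.\<close>

lemma bessel_series_half:
  shows bessel_series_minus_half: "bessel_series (- 1 / 2) (t\<^sup>2 / 4) = cos t / sqrt pi"
    and bessel_series_plus_half: "t / 2 * bessel_series (1 / 2) (t\<^sup>2 / 4) = sin t / sqrt pi"
proof -
  define c where "c = (\<lambda>t. bessel_series (- 1 / 2) (t\<^sup>2 / 4))"
  define s where "s = (\<lambda>t. t / 2 * bessel_series (1 / 2) (t\<^sup>2 / 4))"
  have c': "(c has_field_derivative - s t) (at t)" for t
    using bessel_series_comp_deriv[of "-1/2" t] unfolding c_def s_def by simp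
  have s': "(s has_field_derivative c t) (at t)" for t
    unfolding c_def s_def
    by (rule DERIV_cong[OF DERIV_mult[OF DERIV_cdivide[OF DERIV_ident] bessel_series_comp_deriv]])
       (use bessel_series_contiguous[of "1/2" "t\<^sup>2 / 4"] in \<open>simp add: power2_eq_square\<close>)
  define q where "q = 1 / sqrt pi"
  let ?D = "\<lambda>t. (c t - cos t * q)\<^sup>2 + (s t - sin t * q)\<^sup>2"
  have "(?D has_field_derivative 0) (at t)" for t
    by (rule derivative_eq_intros c' s' refl | simp)+ (simp add: algebra_simps)
  then have "?D t = ?D 0"
    by (intro DERIV_isconst_all) auto
  also have "?D 0 = 0"
    by (simp add: c_def s_def q_def bessel_series_0 rGamma_inverse_Gamma Gamma_one_half_real field_simps)
  finally have "c t = cos t / sqrt pi" "s t = sin t / sqrt pi"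
    by (simp_all add: sum_power2_eq_zero_iff q_def)
  then show "bessel_series (- 1 / 2) (t\<^sup>2 / 4) = cos t / sqrt pi"
    "t / 2 * bessel_series (1 / 2) (t\<^sup>2 / 4) = sin t / sqrt pi"
    by (simp_all add: c_def s_def)
qed

section \<open>Spherical Bessel and Neumann functions: derivatives, recurrences, Wronskian\<close>

lemma bessel_J_eq:
  assumes "t > 0"
  shows "bessel_J \<nu> t = (t / 2) powr \<nu> * bessel_series \<nu> (t\<^sup>2 / 4)"
proof -
  have "(t / 2) powr (\<nu> + 2 * real l) = (t / 2) powr \<nu> * (t\<^sup>2 / 4) ^ l" for l
    using assms by (simp add: powr_add powr_realpow[of "t/2" "2 * l", simplified] power_mult power_divide)
  then show ?thesis
    unfolding bessel_J_def bessel_series_def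
    by (subst suminf_mult[symmetric, OF summable_bessel_series]) (simp add: mult_ac)
qed

lemma sph_bessel_j_eq:
  assumes "t > 0"
  shows "sph_bessel_j n t = sqrt pi / 2 * (t / 2) ^ n * bessel_series (real n + 1 / 2) (t\<^sup>2 / 4)"
proof -
  have "sqrt (pi / (2 * t)) * (t / 2) powr (real n + 1/2) = sqrt pi / 2 * (t / 2) ^ n"
    using assms by (simp add: powr_add powr_realpow powr_half_sqrt real_sqrt_divide real_sqrt_mult)
  then show ?thesis using assms by (simp add: sph_bessel_j_def bessel_J_eq)
qed

text \<open>At half-integer order the cosine in \<open>bessel_Y\<close> vanishes and the sine is
  \<open>(-1)^n\<close>, so only the Bessel function of negative order survives.\<close>

lemma sph_bessel_y_eq:
  assumes "t > 0"
  shows "sph_bessel_y n t =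
    (-1) ^ Suc n * sqrt pi / 2 * bessel_series (- real n - 1 / 2) (t\<^sup>2 / 4) / (t / 2) ^ Suc n"
proof -
  have "cos ((real n + 1/2) * pi) = 0" "sin ((real n + 1/2) * pi) = (-1) ^ n"
    by (simp_all add: distrib_right cos_add sin_add)
  then have y: "bessel_Y (real n + 1/2) t = (-1) ^ Suc n * bessel_J (- real n - 1/2) t"
    by (simp add: bessel_Y_def) (simp add: divide_simps)
  have e: "- real n - 1/2 = - (real n + 1/2)" by simp
  have "sqrt (pi / (2 * t)) * (t / 2) powr (- real n - 1/2) = sqrt pi / 2 / (t / 2) ^ Suc n"
    unfolding e powr_minus powr_add using assms
    by (simp add: powr_realpow powr_half_sqrt real_sqrt_divide real_sqrt_mult field_simps)
  note * = this
  have "sph_bessel_y n t = (-1) ^ Suc n * (sqrt (pi / (2 * t)) * (t / 2) powr (- real n - 1/2))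
      * bessel_series (- real n - 1 / 2) (t\<^sup>2 / 4)"
    unfolding sph_bessel_y_def y bessel_J_eq[OF assms] by (simp only: mult_ac)
  then show ?thesis unfolding * by simp
qed

lemma DERIV_cong_pos:
  fixes f g :: "real \<Rightarrow> real"
  assumes "\<And>t. t > 0 \<Longrightarrow> f t = g t" "t > 0" "(g has_field_derivative D) (at t)"
  shows "(f has_field_derivative D) (at t)"
  using assms(3) by (rule has_field_derivative_transform_within_open[where S = "{0<..}"]) (use assms in auto)

lemma power_scaled_deriv:
  assumes "t > 0"
  shows "((\<lambda>t. (t / 2) ^ n) has_field_derivative real n / t * (t / 2) ^ n) (at (t :: real))"
  by (rule DERIV_cong[OF DERIV_power[OF DERIV_cdivide[OF DERIV_ident]]])
     (cases n, use assms in simp_all)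

lemma sph_bessel_j_deriv:
  assumes "t > 0"
  shows "(sph_bessel_j n has_field_derivative real n / t * sph_bessel_j n t - sph_bessel_j (Suc n) t) (at t)"
proof (rule DERIV_cong_pos[OF sph_bessel_j_eq assms], assumption)
  let ?E = "\<lambda>n t. bessel_series (real n + 1 / 2) (t\<^sup>2 / 4)"
  have e: "real (Suc n) + 1 / 2 = real n + 1 / 2 + 1" by simp
  show "((\<lambda>t. sqrt pi / 2 * (t / 2) ^ n * ?E n t) has_real_derivative
      real n / t * sph_bessel_j n t - sph_bessel_j (Suc n) t) (at t)"
    unfolding sph_bessel_j_eq[OF assms] e power_Suc
    by (rule DERIV_cong[OF DERIV_mult[OF DERIV_cmult[OF power_scaled_deriv[OF assms]] bessel_series_comp_deriv]])
       (simp add: mult_ac)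
qed

lemma sph_bessel_j_contiguous:
  assumes "t > 0"
  shows "sph_bessel_j n t + sph_bessel_j (Suc (Suc n)) t = (2 * real n + 3) / t * sph_bessel_j (Suc n) t"
proof -
  have *: "bessel_series (real n + 1 / 2) (t\<^sup>2 / 4) = (real n + 3 / 2) * bessel_series (real n + 3 / 2) (t\<^sup>2 / 4)
       - t / 2 * (t / 2) * bessel_series (real n + 5 / 2) (t\<^sup>2 / 4)"
  proof -
    have "real n + 3 / 2 - 1 = real n + 1 / 2" "real n + 3 / 2 + 1 = real n + 5 / 2" by auto
    then show ?thesis
      using bessel_series_contiguous[of "real n + 3 / 2" "t\<^sup>2 / 4"] by (simp add: power2_eq_square add_ac)
  qed
  have e: "real (Suc n) + 1 / 2 = real n + 3 / 2" "real (Suc (Suc n)) + 1 / 2 = real n + 5 / 2" by simp_all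
  define a where "a = sqrt pi / 2 * (t / 2) ^ n"
  have "a * ((real n + 3 / 2) * E2 - t / 2 * (t / 2) * E3) + a * (t / 2) * (t / 2) * E3
    = (2 * real n + 3) / t * (a * (t / 2) * E2)" for E2 E3
    using assms by (simp add: field_simps)
  from this[of "bessel_series (real n + 3 / 2) (t\<^sup>2 / 4)" "bessel_series (real n + 5 / 2) (t\<^sup>2 / 4)"] show ?thesis
    unfolding sph_bessel_j_eq[OF assms] e * power_Suc a_def by (simp only: mult_ac)
qed

lemma sph_bessel_y_deriv_Suc:
  assumes "t > 0"
  shows "(sph_bessel_y (Suc n) has_field_derivative
    sph_bessel_y n t - (real n + 2) / t * sph_bessel_y (Suc n) t) (at t)"
proof (rule DERIV_cong_pos[OF sph_bessel_y_eq assms], assumption)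
  let ?E = "\<lambda>n t. bessel_series (- real n - 1 / 2) (t\<^sup>2 / 4)"
  have e: "- real n - 1 / 2 = - real (Suc n) - 1 / 2 + 1" by simp
  define a where "a = (t / 2) ^ Suc n"
  have "a > 0" using assms by (simp add: a_def)
  then have *: "(c * (- (t / 2) * E1) * (t / 2 * a) - c * E2 * (real (Suc (Suc n)) / t * (t / 2 * a)))
       / (t / 2 * a * (t / 2 * a))
      = - c * E1 / a - (real n + 2) / t * (c * E2 / (t / 2 * a))" for c E1 E2
    using assms by (simp add: divide_simps) (simp add: algebra_simps)
  show "((\<lambda>t. (-1) ^ Suc (Suc n) * sqrt pi / 2 * ?E (Suc n) t / (t / 2) ^ Suc (Suc n)) has_real_derivative
      sph_bessel_y n t - (real n + 2) / t * sph_bessel_y (Suc n) t) (at t)"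
    unfolding sph_bessel_y_eq[OF assms] e
    by (rule DERIV_cong[OF DERIV_divide[OF DERIV_cmult[OF bessel_series_comp_deriv] power_scaled_deriv[OF assms]]])
       (use assms in simp, unfold power_Suc[of _ "Suc n"] a_def[symmetric] *, simp)
qed

lemma sph_bessel_y_contiguous:
  assumes "t > 0"
  shows "sph_bessel_y n t + sph_bessel_y (Suc (Suc n)) t = (2 * real n + 3) / t * sph_bessel_y (Suc n) t"
proof -
  have *: "bessel_series (- real n - 5 / 2) (t\<^sup>2 / 4) = (- real n - 3 / 2) * bessel_series (- real n - 3 / 2) (t\<^sup>2 / 4)
       - t / 2 * (t / 2) * bessel_series (- real n - 1 / 2) (t\<^sup>2 / 4)"
    using bessel_series_contiguous[of "- real n - 3 / 2" "t\<^sup>2 / 4"] by (simp add: algebra_simps power2_eq_square)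
  have e: "- real (Suc (Suc n)) - 1 / 2 = - real n - 5 / 2" "- real (Suc n) - 1 / 2 = - real n - 3 / 2"
    by auto
  define a where "a = (t / 2) ^ Suc n"
  have "a > 0" using assms by (simp add: a_def)
  then have "c * E1 / a + c * ((- real n - 3 / 2) * E2 - t / 2 * (t / 2) * E1) / (t / 2 * (t / 2 * a))
      = (2 * real n + 3) / t * (- c * E2 / (t / 2 * a))" for c E1 E2
    using assms by (simp add: divide_simps) (simp add: algebra_simps)
  from this[of "(-1) ^ Suc n * sqrt pi / 2"] show ?thesis
    unfolding sph_bessel_y_eq[OF assms] e * power_Suc[of _ "Suc n"] power_Suc[of _ "Suc (Suc n)"] a_def[symmetric]
    by simp
qed

lemma sph_bessel_j_0: "t > 0 \<Longrightarrow> sph_bessel_j 0 t = sin t / t"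
  using bessel_series_plus_half[of t] by (simp add: sph_bessel_j_eq field_simps)

lemma sph_bessel_y_0: "t > 0 \<Longrightarrow> sph_bessel_y 0 t = - cos t / t"
  using bessel_series_minus_half[of t] by (simp add: sph_bessel_y_eq field_simps)

text \<open>Differentiating the series of negative order lowers the index and so says nothing about
  index 0. For positive index the three-term recurrence converts that rule into this one; for index
  0 the explicit forms of the first two functions are used.\<close>

lemma sph_bessel_y_deriv:
  assumes "t > 0"
  shows "(sph_bessel_y n has_field_derivative real n / t * sph_bessel_y n t - sph_bessel_y (Suc n) t) (at t)"
proof (cases n)
  case 0
  have "bessel_series (- 3 / 2) (t\<^sup>2 / 4) = - cos t / sqrt pi / 2 - t / 2 * (sin t / sqrt pi)"
    using bessel_series_contiguous[of "- 1 / 2" "t\<^sup>2 / 4"] bessel_series_minus_half[of t]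
    by (simp flip: bessel_series_plus_half add: power2_eq_square)
  then have y1: "sph_bessel_y (Suc 0) t = - cos t / t\<^sup>2 - sin t / t"
    using assms by (simp add: sph_bessel_y_eq field_simps power2_eq_square)
  show ?thesis unfolding 0
    by (rule DERIV_cong_pos[OF sph_bessel_y_0 assms], assumption)
       (use assms in \<open>auto intro!: derivative_eq_intros simp: y1 field_simps power2_eq_square\<close>)
next
  case (Suc m)
  show ?thesis unfolding Suc
    by (rule DERIV_cong[OF sph_bessel_y_deriv_Suc[OF assms]])
       (use sph_bessel_y_contiguous[OF assms, of m] assms in \<open>simp add: field_simps\<close>)
qed

lemma sph_bessel_j_deriv_Suc:
  assumes "t > 0"
  shows "(sph_bessel_j (Suc n) has_field_derivative
    sph_bessel_j n t - (real n + 2) / t * sph_bessel_j (Suc n) t) (at t)"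
  by (rule DERIV_cong[OF sph_bessel_j_deriv[OF assms]])
     (use sph_bessel_j_contiguous[OF assms, of n] assms in \<open>simp add: field_simps\<close>)

text \<open>The Wronskian with derivatives replaced by neighbouring indices. Both families satisfy
  the same recurrence \<open>u (n+2) = (2 n + 3) / t * u (n+1) - u n\<close>, which leaves this
  determinant unchanged, so it only has to be computed for index 0.\<close>

lemma sph_bessel_cross:
  assumes "t > 0"
  shows "sph_bessel_j (Suc n) t * sph_bessel_y n t - sph_bessel_j n t * sph_bessel_y (Suc n) t = 1 / t\<^sup>2"
proof (induction n)
  case 0
  have "((\<lambda>t. sin t / t) has_field_derivative - sph_bessel_j (Suc 0) t) (at t)"
    by (rule DERIV_cong_pos[where g = "sph_bessel_j 0", OF _ assms])
       (use sph_bessel_j_deriv[OF assms, of 0] sph_bessel_j_0 in simp_all)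
  moreover have "((\<lambda>t. sin t / t) has_field_derivative (cos t * t - sin t) / t\<^sup>2) (at t)"
    using assms by (auto intro!: derivative_eq_intros simp: power2_eq_square)
  ultimately have j1: "sph_bessel_j (Suc 0) t = - ((cos t * t - sin t) / t\<^sup>2)"
    by (metis DERIV_unique minus_minus)
  have "((\<lambda>t. - cos t / t) has_field_derivative - sph_bessel_y (Suc 0) t) (at t)"
    by (rule DERIV_cong_pos[where g = "sph_bessel_y 0", OF _ assms])
       (use sph_bessel_y_deriv[OF assms, of 0] sph_bessel_y_0 in simp_all)
  moreover have "((\<lambda>t. - cos t / t) has_field_derivative (sin t * t + cos t) / t\<^sup>2) (at t)"
    using assms by (auto intro!: derivative_eq_intros simp: power2_eq_square) (simp add: field_simps)
  ultimately have y1: "sph_bessel_y (Suc 0) t = - ((sin t * t + cos t) / t\<^sup>2)"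
    by (metis DERIV_unique minus_minus)
  have "t * ((sin t)\<^sup>2 + (cos t)\<^sup>2) = t" by (simp only: sin_cos_squared_add mult_1_right)
  then have num: "(cos t * t - sin t) * cos t + (sin t * t + cos t) * sin t = t"
    by (simp only: algebra_simps power2_eq_square)
  have "sph_bessel_j (Suc 0) t * sph_bessel_y 0 t - sph_bessel_j 0 t * sph_bessel_y (Suc 0) t
    = ((cos t * t - sin t) * cos t + (sin t * t + cos t) * sin t) / (t\<^sup>2 * t)"
    using assms by (simp add: sph_bessel_j_0 sph_bessel_y_0 j1 y1 divide_simps)
  then show ?case unfolding num using assms by simp
next
  case (Suc n)
  have j: "sph_bessel_j (Suc (Suc n)) t = (2 * real n + 3) / t * sph_bessel_j (Suc n) t - sph_bessel_j n t"
    using sph_bessel_j_contiguous[OF assms, of n] by simp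
  have y: "sph_bessel_y (Suc (Suc n)) t = (2 * real n + 3) / t * sph_bessel_y (Suc n) t - sph_bessel_y n t"
    using sph_bessel_y_contiguous[OF assms, of n] by simp
  show ?case unfolding j y using Suc by (simp add: algebra_simps)
qed

section \<open>The eigenvalue integral\<close>

text \<open>The function \<open>A\<close> of the overview: two unit vectors at distance
  \<open>r\<close> enclose an angle with cosine \<open>1 - r^2/2\<close>.\<close>

definition chord_transform :: "nat \<Rightarrow> real \<Rightarrow> complex" where
  "chord_transform n k = integral {0..2} (\<lambda>r. cis (k * r) * of_real (poly (legendre_poly n) (1 - r\<^sup>2 / 2)))"

lemma cis_scaled_vector_derivative [derivative_intros]:
  "((\<lambda>k. cis (k * r)) has_vector_derivative \<i> * of_real r * cis (k * r)) (at k within S)"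
proof -
  have "((\<lambda>k. exp (\<i> * of_real r * of_real k)) has_vector_derivative (\<i> * of_real r * exp (\<i> * of_real r * of_real k))) (at k within S)"
    by (rule has_vector_derivative_real_field) (auto intro!: derivative_eq_intros)
  then show ?thesis by (simp add: cis_conv_exp mult_ac)
qed

lemma continuous_on_cis_scaled [continuous_intros]:
  "continuous_on S f \<Longrightarrow> continuous_on S (\<lambda>x. cis (f x))"
  unfolding cis_conv_exp by (intro continuous_intros)

text \<open>Differentiation under the integral. The case \<open>k = 0\<close> is included because
  continuity there later fixes the constant of integration.\<close>

lemma chord_transform_deriv:
  "(chord_transform n has_vector_derivative
     integral {0..2} (\<lambda>r. \<i> * of_real r * cis (k * r) * of_real (poly (legendre_poly n) (1 - r\<^sup>2 / 2)))) (at k)"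
  unfolding chord_transform_def cbox_interval[symmetric]
  by (rule leibniz_rule_vector_derivative[where U = UNIV, simplified])
     (auto intro!: derivative_eq_intros continuous_intros integrable_continuous_interval simp: split_beta)

text \<open>With \<open>t = 1 - r^2/2\<close> the operator \<open>r d/dr\<close> becomes
  \<open>2 (t - 1) d/dt\<close>. Hence the derivative of \<open>r\<close> times a sum of neighbours
  is the sum plus \<open>2 (t - 1)\<close> times its \<open>t\<close>-derivative, and the contiguous
  relation applies.\<close>

lemma poly_legendre_chord_deriv:
  "((\<lambda>r. r * (poly (legendre_poly n) (1 - r\<^sup>2 / 2) + poly (legendre_poly (Suc n)) (1 - r\<^sup>2 / 2)))
     has_field_derivative (2 * real n + 3) * poly (legendre_poly (Suc n)) (1 - r\<^sup>2 / 2)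
       - (2 * real n + 1) * poly (legendre_poly n) (1 - r\<^sup>2 / 2)) (at r within S)"
proof -
  have *: "((\<lambda>r. poly p (1 - r\<^sup>2 / 2)) has_field_derivative (poly (pderiv p) (1 - r\<^sup>2 / 2) * (- r))) (at r within S)" for p
    by (rule DERIV_chain2[OF poly_DERIV]) (auto intro!: derivative_eq_intros)
  show ?thesis
    by (rule DERIV_cong[OF DERIV_mult[OF DERIV_ident DERIV_add[OF * *]]])
       (use poly_legendre_contiguous[of "1 - r\<^sup>2 / 2" n] in \<open>simp add: algebra_simps power2_eq_square\<close>)
qed

text \<open>Integration by parts of \<open>cis (k r)\<close> against the exact derivative just
  found. The two integrals on the left are the \<open>k\<close>-derivatives of
  \<open>chord_transform\<close> at \<open>n\<close> and \<open>Suc n\<close>.\<close>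

lemma chord_transform_contiguous:
  assumes "k > 0"
  shows "integral {0..2} (\<lambda>r. \<i> * of_real r * cis (k * r) * of_real (poly (legendre_poly n) (1 - r\<^sup>2 / 2)))
       + integral {0..2} (\<lambda>r. \<i> * of_real r * cis (k * r) * of_real (poly (legendre_poly (Suc n)) (1 - r\<^sup>2 / 2)))
     = of_real ((2 * real n + 1) / k) * chord_transform n k - of_real ((2 * real n + 3) / k) * chord_transform (Suc n) k"
proof -
  let ?p = "\<lambda>n r. poly (legendre_poly n) (1 - r\<^sup>2 / 2)"
  let ?q = "\<lambda>r. r * (?p n r + ?p (Suc n) r)"
  have "((\<lambda>r. cis (k * r) * complex_of_real (?q r)) has_vector_derivative
      cis (k * r) * of_real ((2 * real n + 3) * ?p (Suc n) r - (2 * real n + 1) * ?p n r)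
        + \<i> * of_real k * cis (k * r) * of_real (?q r)) (at r within {0..2})" for r
    by (rule has_vector_derivative_mult
         cis_scaled_vector_derivative[of k, simplified mult.commute[of _ k]]
         has_vector_derivative_of_real poly_legendre_chord_deriv)+
  then have "((\<lambda>r. cis (k * r) * of_real ((2 * real n + 3) * ?p (Suc n) r - (2 * real n + 1) * ?p n r)
        + \<i> * of_real k * cis (k * r) * of_real (?q r)) has_integral
      (cis (k * 2) * of_real (?q 2) - cis (k * 0) * of_real (?q 0))) {0..2}"
    by (intro fundamental_theorem_of_calculus) auto
  \<comment> \<open>At \<open>r = 2\<close> the Legendre argument is -1, where neighbouring
    polynomials take opposite values; at \<open>r = 0\<close> the factor \<open>r\<close>
    vanishes.\<close>
  moreover have "?q 2 = 0" using poly_legendre_at_endpoint[of "-1"] by simp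
  then have "cis (k * 2) * complex_of_real (?q 2) - cis (k * 0) * of_real (?q 0) = 0"
    by (simp only:) simp
  ultimately have 1: "((\<lambda>r. cis (k * r) * of_real ((2 * real n + 3) * ?p (Suc n) r - (2 * real n + 1) * ?p n r)
        + \<i> * of_real k * cis (k * r) * of_real (?q r)) has_integral 0) {0..2}"
    by (simp only:)
  have A: "((\<lambda>r. cis (k * r) * of_real (?p n r)) has_integral chord_transform n k) {0..2}" for n
    unfolding chord_transform_def
    by (intro integrable_integral integrable_continuous_interval continuous_intros) simp_all
  have B: "((\<lambda>r. \<i> * of_real r * cis (k * r) * of_real (?p n r)) has_integral
      integral {0..2} (\<lambda>r. \<i> * of_real r * cis (k * r) * of_real (?p n r))) {0..2}" (is "(_ has_integral ?B n) _") for n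
    by (intro integrable_integral integrable_continuous_interval continuous_intros) simp_all
  have "((\<lambda>r. cis (k * r) * of_real ((2 * real n + 3) * ?p (Suc n) r - (2 * real n + 1) * ?p n r)
        + \<i> * of_real k * cis (k * r) * of_real (?q r)) has_integral
     (of_real (2 * real n + 3) * chord_transform (Suc n) k - of_real (2 * real n + 1) * chord_transform n k
      + of_real k * (?B n + ?B (Suc n)))) {0..2}"
    by (rule has_integral_eq[rotated, OF has_integral_add[OF has_integral_diff[OF
         has_integral_mult_right[OF A] has_integral_mult_right[OF A]]
         has_integral_mult_right[OF has_integral_add[OF B B]]]])
       (simp add: algebra_simps)
  from has_integral_unique[OF this 1]
  have "of_real k * (?B n + ?B (Suc n))
      = of_real (2 * real n + 1) * chord_transform n k - of_real (2 * real n + 3) * chord_transform (Suc n) k"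
    by algebra
  then have "?B n + ?B (Suc n) = (of_real (2 * real n + 1) * chord_transform n k
      - of_real (2 * real n + 3) * chord_transform (Suc n) k) / of_real k"
    using assms by (simp only: nonzero_eq_divide_eq of_real_eq_0_iff mult.commute[of "complex_of_real k"]
        less_imp_neq[symmetric] not_False_eq_True)
  then show ?thesis
    by (simp only: of_real_divide diff_divide_distrib times_divide_eq_left)
qed

lemma sph_hankel1_deriv:
  assumes "t > 0"
  shows "(sph_hankel1 n has_vector_derivative of_real (real n / t) * sph_hankel1 n t - sph_hankel1 (Suc n) t) (at t)"
  unfolding sph_hankel1_def
  by (rule has_vector_derivative_eq_rhs[OF has_vector_derivative_add[OF
        has_vector_derivative_of_real[OF sph_bessel_j_deriv[OF assms]]
        has_vector_derivative_mult_right[OF has_vector_derivative_of_real[OF sph_bessel_y_deriv[OF assms]]]]])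
     (simp add: algebra_simps)

lemma sph_hankel1_deriv_Suc:
  assumes "t > 0"
  shows "(sph_hankel1 (Suc n) has_vector_derivative
    sph_hankel1 n t - of_real ((real n + 2) / t) * sph_hankel1 (Suc n) t) (at t)"
  unfolding sph_hankel1_def
  by (rule has_vector_derivative_eq_rhs[OF has_vector_derivative_add[OF
        has_vector_derivative_of_real[OF sph_bessel_j_deriv_Suc[OF assms]]
        has_vector_derivative_mult_right[OF has_vector_derivative_of_real[OF sph_bessel_y_deriv_Suc[OF assms]]]]])
     (simp add: algebra_simps)

section \<open>The closed form of the chord transform and the eigenvalue\<close>

definition bessel_hankel :: "nat \<Rightarrow> real \<Rightarrow> complex" where
  "bessel_hankel n k = 2 * \<i> * of_real k * (of_real (sph_bessel_j n k) * sph_hankel1 n k)"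

lemma bessel_hankel_deriv:
  assumes "(sph_bessel_j n has_field_derivative j') (at k)"
    and "(sph_hankel1 n has_vector_derivative h') (at k)"
  shows "(bessel_hankel n has_vector_derivative 2 * \<i> * (of_real (sph_bessel_j n k) * sph_hankel1 n k
    + of_real k * (of_real (sph_bessel_j n k) * h' + of_real j' * sph_hankel1 n k))) (at k)"
  unfolding bessel_hankel_def
  by (rule has_vector_derivative_eq_rhs[OF has_vector_derivative_mult[OF has_vector_derivative_mult_right[OF
        has_vector_derivative_of_real[OF DERIV_ident]] has_vector_derivative_mult[OF
        has_vector_derivative_of_real[OF assms(1)] assms(2)]]])
     (simp add: algebra_simps)

text \<open>The index-raising rule at \<open>n\<close> and the index-lowering rule at
  \<open>Suc n\<close> express both derivatives through the same four functions. The mixed products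
  enter with opposite signs and cancel, leaving the recursion of
  \<open>chord_transform\<close>.\<close>

lemma bessel_hankel_contiguous:
  assumes "k > 0"
    and "(bessel_hankel n has_vector_derivative D) (at k)"
    and "(bessel_hankel (Suc n) has_vector_derivative D') (at k)"
  shows "D + D' = of_real ((2 * real n + 1) / k) * bessel_hankel n k
    - of_real ((2 * real n + 3) / k) * bessel_hankel (Suc n) k"
proof -
  note D = vector_derivative_unique_at[OF assms(2)
      bessel_hankel_deriv[OF sph_bessel_j_deriv sph_hankel1_deriv, OF assms(1,1)]]
  note D' = vector_derivative_unique_at[OF assms(3)
      bessel_hankel_deriv[OF sph_bessel_j_deriv_Suc sph_hankel1_deriv_Suc, OF assms(1,1)]]
  show ?thesis
    unfolding D D' bessel_hankel_def using assms(1) by (simp add: field_simps)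
qed

text \<open>The growth of the Neumann function at 0 is harmless: its power of \<open>k/2\<close>
  times that of the Bessel function is \<open>(k/2)^(-1)\<close>, absorbed by the factor
  \<open>k\<close>. So \<open>bessel_hankel\<close> agrees for positive \<open>k\<close> with the
  function \<open>F\<close>, continuous at 0, and a positive power of \<open>k\<close> forces the
  limit 0.\<close>

lemma bessel_hankel_tendsto_0: "((\<lambda>k. of_real (k ^ Suc m) * bessel_hankel n k) \<longlongrightarrow> 0) (at_right 0)"
proof -
  define E1 where "E1 = (\<lambda>k. bessel_series (real n + 1 / 2) (k\<^sup>2 / 4))"
  define E2 where "E2 = (\<lambda>k. bessel_series (- real n - 1 / 2) (k\<^sup>2 / 4))"
  define F where "F = (\<lambda>k. 2 * \<i> * of_real (k * (sqrt pi / 2 * (k / 2) ^ n * E1 k)\<^sup>2)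
       - of_real ((-1) ^ Suc n * pi * (E1 k * E2 k)))"
  have E: "isCont E1 k" "isCont E2 k" for k
    unfolding E1_def E2_def by (rule DERIV_isCont[OF bessel_series_comp_deriv])+
  have "isCont (\<lambda>k. of_real (k ^ Suc m) * F k) 0"
    unfolding F_def by (intro continuous_intros E) simp_all
  then have "((\<lambda>k. of_real (k ^ Suc m) * F k) \<longlongrightarrow> 0) (at_right 0)"
    by (auto simp: isCont_def intro: filterlim_mono[OF _ order_refl at_le])
  moreover have "\<forall>\<^sub>F k in at_right 0. of_real (k ^ Suc m) * F k = of_real (k ^ Suc m) * bessel_hankel n k"
    unfolding eventually_at_right_field
  proof (intro exI[of _ 1] conjI allI impI)
    fix k :: real assume "k > 0"
    have "k * (sph_bessel_j n k * sph_bessel_y n k) = (-1) ^ Suc n * (pi / 2) * (E1 k * E2 k)"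
      using \<open>k > 0\<close> unfolding sph_bessel_j_eq[OF \<open>k > 0\<close>] sph_bessel_y_eq[OF \<open>k > 0\<close>] E1_def E2_def
      by simp
    moreover have "bessel_hankel n k = 2 * \<i> * of_real (k * (sph_bessel_j n k)\<^sup>2)
      - 2 * of_real (k * (sph_bessel_j n k * sph_bessel_y n k))"
      by (simp add: bessel_hankel_def sph_hankel1_def algebra_simps power2_eq_square)
    ultimately have "bessel_hankel n k = F k"
      by (simp add: sph_bessel_j_eq[OF \<open>k > 0\<close>] F_def E1_def)
    then show "of_real (k ^ Suc m) * F k = of_real (k ^ Suc m) * bessel_hankel n k" by simp
  qed simp
  ultimately show ?thesis by (rule Lim_transform_eventually)
qed

text \<open>Both sides satisfy the same first-order recursion in \<open>n\<close>, whose homogeneous solutions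
  \<open>k powr - (2 n + 3)\<close> are excluded by the behaviour at \<open>0\<close>.\<close>

lemma chord_transform_eq:
  assumes "k > 0"
  shows "chord_transform n k = bessel_hankel n k"
  using assms
proof (induction n arbitrary: k)
  case 0
  have "((\<lambda>r. cis (k * r) / (\<i> * k)) has_vector_derivative cis (k * r)) (at r within {0..2})" for r
    by (rule has_vector_derivative_eq_rhs[OF has_vector_derivative_divide
        [OF cis_scaled_vector_derivative[of k, simplified mult.commute[of _ k]]]])
       (use 0 in simp)
  then have "((\<lambda>r. cis (k * r)) has_integral (cis (k * 2) / (\<i> * k) - cis (k * 0) / (\<i> * k))) {0..2}"
    by (intro fundamental_theorem_of_calculus) auto
  then have "chord_transform 0 k = cis (k * 2) / (\<i> * k) - 1 / (\<i> * k)"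
    by (simp add: chord_transform_def legendre_poly_def integral_unique)
  also have "\<dots> = 2 * of_real (sin k) * cis k / of_real k"
  proof -
    have "cis (k * 2) = cis k * cis k" by (simp add: cis_mult mult.commute)
    moreover have "cis k * cis (- k) = 1" by (simp add: cis_mult)
    moreover have "cis k - cis (- k) = 2 * \<i> * of_real (sin k)" by (simp add: complex_eq_iff)
    ultimately have "cis (k * 2) - 1 = 2 * \<i> * of_real (sin k) * cis k"
      by (metis mult.commute right_diff_distrib)
    then show ?thesis using 0 by (simp add: diff_divide_distrib[symmetric] divide_simps)
  qed
  also have "\<dots> = bessel_hankel 0 k"
    using 0 by (simp add: bessel_hankel_def sph_hankel1_def sph_bessel_j_0 sph_bessel_y_0 complex_eq_iff
        power2_eq_square field_simps)
  finally show ?case .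
next
  case (Suc n)
  define d where "d = (\<lambda>n k. chord_transform n k - bessel_hankel n k)"
  \<comment> \<open>The power is the integrating factor of \<open>d' = - ((2 n + 3) / k) d\<close>,
    the equation left for the difference at \<open>Suc n\<close>.\<close>
  define D where "D = (\<lambda>k. of_real (k ^ (2 * n + 3)) * d (Suc n) k)"
  obtain c where c: "\<And>k. k \<in> {0<..} \<Longrightarrow> D k = c"
  proof (rule has_vector_derivative_zero_constant[of "{0<..}" D])
    fix k :: real assume "k \<in> {0<..}"
    then have k: "k > 0" by simp
    obtain A B where AB: "(chord_transform n has_vector_derivative A) (at k)"
      "(chord_transform (Suc n) has_vector_derivative B) (at k)"
      and ABeq: "A + B = of_real ((2 * real n + 1) / k) * chord_transform n k
          - of_real ((2 * real n + 3) / k) * chord_transform (Suc n) k"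
      using chord_transform_deriv chord_transform_contiguous[OF k] by blast
    obtain A' B' where AB': "(bessel_hankel n has_vector_derivative A') (at k)"
      "(bessel_hankel (Suc n) has_vector_derivative B') (at k)"
      using bessel_hankel_deriv[OF sph_bessel_j_deriv sph_hankel1_deriv] k by blast
    note AB'eq = bessel_hankel_contiguous[OF k AB']
    \<comment> \<open>The induction hypothesis is available for all positive arguments, hence near
      \<open>k\<close>, and so identifies the derivatives as well as the values.\<close>
    have "(bessel_hankel n has_vector_derivative A) (at k)"
      using AB(1) by (rule has_vector_derivative_transform_within_open[where S = "{0<..}"]) (use k Suc.IH in auto)
    then have "A = A'" using AB'(1) by (rule vector_derivative_unique_at)
    then have "B - B' = - of_real ((2 * real n + 3) / k) * d (Suc n) k"
    proof -
      define c where "c = complex_of_real ((2 * real n + 3) / k)"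
      have "A + B = of_real ((2 * real n + 1) / k) * bessel_hankel n k - c * chord_transform (Suc n) k"
        "A + B' = of_real ((2 * real n + 1) / k) * bessel_hankel n k - c * bessel_hankel (Suc n) k"
        using ABeq AB'eq Suc.IH[OF k] \<open>A = A'\<close> unfolding c_def by simp_all
      then have "B - B' = - c * (chord_transform (Suc n) k - bessel_hankel (Suc n) k)"
        by algebra
      then show ?thesis unfolding c_def d_def .
    qed
    moreover have "(D has_vector_derivative of_real (k ^ (2 * n + 3)) * (B - B')
        + of_real (real (2 * n + 3) * k ^ (2 * n + 2)) * d (Suc n) k) (at k)"
      unfolding D_def d_def
      by (rule has_vector_derivative_mult[OF has_vector_derivative_of_real has_vector_derivative_diff[OF AB(2) AB'(2)]])
         (auto intro!: derivative_eq_intros)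
    moreover have "of_real (k ^ (2 * n + 3)) * (- of_real ((2 * real n + 3) / k) * d (Suc n) k)
        + of_real (real (2 * n + 3) * k ^ (2 * n + 2)) * d (Suc n) k = 0"
    proof -
      have "k ^ (2 * n + 3) * ((2 * real n + 3) / k) = real (2 * n + 3) * k ^ (2 * n + 2)"
        using k by (simp add: power_add power3_eq_cube power2_eq_square)
      then have "complex_of_real (k ^ (2 * n + 3)) * of_real ((2 * real n + 3) / k)
          = of_real (real (2 * n + 3) * k ^ (2 * n + 2))"
        by (simp only: of_real_mult[symmetric])
      then show ?thesis
        by (simp only: mult_minus_left mult_minus_right mult.assoc[symmetric] left_minus)
    qed
    ultimately show "(D has_vector_derivative 0) (at k within {0<..})"
      by (simp only: has_vector_derivative_at_within)
  qed auto
  have "((\<lambda>k. of_real (k ^ (2 * n + 3)) * chord_transform (Suc n) k) \<longlongrightarrow> of_real (0 ^ (2 * n + 3)) * chord_transform (Suc n) 0) (at_right 0)"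
    by (intro tendsto_intros isContD[THEN filterlim_mono[OF _ order_refl at_le]]
        has_vector_derivative_continuous[OF chord_transform_deriv]) auto
  note t1 = this
  have e: "Suc (2 * n + 2) = 2 * n + 3" by simp
  note t2 = bessel_hankel_tendsto_0[of "2 * n + 2" "Suc n", unfolded e]
  have z: "complex_of_real (0 ^ (2 * n + 3)) * chord_transform (Suc n) 0 - 0 = 0" by simp
  have "(D \<longlongrightarrow> 0) (at_right 0)"
    unfolding D_def d_def right_diff_distrib using tendsto_diff[OF t1 t2] unfolding z .
  moreover have "(D \<longlongrightarrow> c) (at_right 0)"
    by (rule Lim_transform_eventually[OF tendsto_const])
       (use c in \<open>auto simp: eventually_at_right_field intro!: exI[of _ 1]\<close>)
  ultimately have "c = 0" using tendsto_unique trivial_limit_at_right_real by blast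
  then show ?case using c[of k] \<open>k > 0\<close> by (simp add: D_def d_def)
qed

text \<open>On \<open>A = 2 \<i> k j h\<close> the operator \<open>1 - k d/dk\<close> leaves
  \<open>- 2 \<i> k^2 (j h' + j' h)\<close>. The Wronskian \<open>W\<close> trades either summand
  for the other at the cost of a constant, which becomes \<open>- 1/2\<close> or \<open>1/2\<close>
  after division by 4.\<close>

lemma np_eigenvalue:
  fixes k :: real and n :: nat
  assumes k: "k > 0"
  defines "I \<equiv> integral {0..2} (\<lambda>r. (1 - \<i> * of_real (k * r)) * cis (k * r) * of_real (poly (legendre_poly n) (1 - r\<^sup>2 / 2)))"
  shows "I / 4 = - 1 / 2 - \<i> * of_real (k\<^sup>2 * sph_bessel_j n k) * vector_derivative (sph_hankel1 n) (at k)"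
    and "I / 4 = 1 / 2 - \<i> * of_real (k\<^sup>2 * deriv (sph_bessel_j n) k) * sph_hankel1 n k"
proof -
  let ?p = "\<lambda>r. poly (legendre_poly n) (1 - r\<^sup>2 / 2)"
  let ?j = "sph_bessel_j n k" and ?h = "sph_hankel1 n k"
  define j' where "j' = real n / k * ?j - sph_bessel_j (Suc n) k"
  define h' where "h' = of_real (real n / k) * ?h - sph_hankel1 (Suc n) k"
  have dj: "deriv (sph_bessel_j n) k = j'"
    unfolding j'_def by (rule DERIV_imp_deriv[OF sph_bessel_j_deriv[OF k]])
  have dh: "vector_derivative (sph_hankel1 n) (at k) = h'"
    unfolding h'_def by (rule vector_derivative_at[OF sph_hankel1_deriv[OF k]])
  have "of_real j' * ?h - of_real ?j * h' = - \<i> * of_real (sph_bessel_j (Suc n) k * sph_bessel_y n k - ?j * sph_bessel_y (Suc n) k)"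
    by (simp add: j'_def h'_def sph_hankel1_def algebra_simps)
  then have W: "of_real j' * ?h - of_real ?j * h' = - \<i> / (of_real k)\<^sup>2"
    unfolding sph_bessel_cross[OF k] by simp
  define B where "B = integral {0..2} (\<lambda>r. \<i> * of_real r * cis (k * r) * of_real (?p r))"
  have "(bessel_hankel n has_vector_derivative B) (at k)"
    using chord_transform_deriv unfolding B_def
    by (rule has_vector_derivative_transform_within_open[where S = "{0<..}"]) (use k chord_transform_eq in auto)
  then have B: "B = 2 * \<i> * (of_real ?j * ?h + of_real k * (of_real ?j * h' + of_real j' * ?h))"
    using bessel_hankel_deriv[OF sph_bessel_j_deriv sph_hankel1_deriv, OF k k, of n]
    unfolding j'_def h'_def by (metis vector_derivative_unique_at)
  have "I = integral {0..2} (\<lambda>r. cis (k * r) * of_real (?p r) - of_real k * (\<i> * of_real r * cis (k * r) * of_real (?p r)))"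
    unfolding I_def by (intro integral_cong) (simp add: algebra_simps)
  also have "\<dots> = chord_transform n k - of_real k * B"
    unfolding B_def chord_transform_def
    by (subst integral_diff) (auto intro!: integrable_continuous_interval continuous_intros)
  also have "\<dots> = - 2 * \<i> * (of_real k)\<^sup>2 * (of_real ?j * h' + of_real j' * ?h)"
    unfolding chord_transform_eq[OF k] bessel_hankel_def B by (simp add: algebra_simps power2_eq_square)
  finally have I: "I = - 2 * \<i> * (of_real k)\<^sup>2 * (of_real ?j * h' + of_real j' * ?h)" .
  have 1: "of_real j' * ?h = of_real ?j * h' - \<i> / (of_real k)\<^sup>2" using W by (simp add: algebra_simps)
  have 2: "of_real ?j * h' = of_real j' * ?h + \<i> / (of_real k)\<^sup>2" using W by (simp add: algebra_simps)
  show "I / 4 = - 1 / 2 - \<i> * of_real (k\<^sup>2 * ?j) * vector_derivative (sph_hankel1 n) (at k)"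
    unfolding dh I 1 using k by (simp add: field_simps)
  show "I / 4 = 1 / 2 - \<i> * of_real (k\<^sup>2 * deriv (sph_bessel_j n) k) * ?h"
    unfolding dj I 2 using k by (simp add: field_simps)
qed

section \<open>Rotation invariance of the surface measure\<close>

lemma vector3_eq_axis: "(vector [a, b, c] :: real^3) = a *\<^sub>R axis 1 1 + b *\<^sub>R axis 2 1 + c *\<^sub>R axis 3 1"
  by (simp add: vec_eq_iff forall_3 axis_def)

lemma has_derivative_vector3:
  assumes "(f has_derivative f') F" "(g has_derivative g') F" "(h has_derivative h') F"
  shows "((\<lambda>x. vector [f x, g x, h x] :: real^3) has_derivative (\<lambda>x. vector [f' x, g' x, h' x])) F"
  unfolding vector3_eq_axis by (intro has_derivative_add has_derivative_scaleR_left assms)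

lemma continuous_on_vector3 [continuous_intros]:
  assumes "continuous_on S f" "continuous_on S g" "continuous_on S h"
  shows "continuous_on S (\<lambda>x. vector [f x, g x, h x] :: real^3)"
  unfolding vector3_eq_axis by (intro continuous_intros assms)

lemma continuous_on_sphere_param: "continuous_on S sphere_param"
  unfolding sphere_param_def split_beta by (intro continuous_intros)

lemma measurable_sphere_param [measurable]: "sphere_param \<in> borel_measurable borel"
  by (intro borel_measurable_continuous_onI continuous_on_sphere_param)

lemma power2_norm_vec3: "(norm (x :: real^3))\<^sup>2 = (x $ 1)\<^sup>2 + (x $ 2)\<^sup>2 + (x $ 3)\<^sup>2"
  unfolding power2_norm_eq_inner by (simp add: inner_vec_def sum_3 power2_eq_square)

lemma norm_sphere_param [simp]: "norm (sphere_param p) = 1"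
proof -
  have "(norm (sphere_param p))\<^sup>2 = (sin (fst p) * cos (snd p))\<^sup>2 + (sin (fst p) * sin (snd p))\<^sup>2 + (cos (fst p))\<^sup>2"
    by (simp only: power2_norm_vec3 sphere_param_def split_beta vector_3)
  also have "\<dots> = (sin (fst p))\<^sup>2 * ((sin (snd p))\<^sup>2 + (cos (snd p))\<^sup>2) + (cos (fst p))\<^sup>2"
    by algebra
  also have "\<dots> = 1" by simp
  finally have "(norm (sphere_param p))\<^sup>2 = 1" .
  then show ?thesis using norm_ge_zero[of "sphere_param p"] by (auto simp: power2_eq_1_iff)
qed

lemma borel_measurable_vec_nth [measurable]: "(\<lambda>x::real^'n. x $ i) \<in> borel_measurable borel"
  by (intro borel_measurable_continuous_onI continuous_intros)

text \<open>Splits Lebesgue measure on \<open>real^3\<close> into a radial line and an angular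
  plane, so that Fubini can separate the Jacobian of spherical coordinates.\<close>

lemma distr_lborel_vector3:
  "distr (lborel \<Otimes>\<^sub>M lborel) borel (\<lambda>(r, p). vector [r, fst p, snd p]) = (lborel :: (real^3) measure)"
proof (rule lborel_eqI[symmetric])
  let ?T = "\<lambda>(r, p). vector [r, fst p, snd p] :: real^3"
  fix l u :: "real^3" assume le: "\<And>b. b \<in> Basis \<Longrightarrow> l \<bullet> b \<le> u \<bullet> b"
  then have le': "l $ i \<le> u $ i" for i
    using le[of "axis i 1"] by (auto simp: inner_axis axis_in_Basis_iff)
  have "continuous_on UNIV ?T" unfolding split_beta by (intro continuous_intros)
  then have T: "?T \<in> borel_measurable (lborel \<Otimes>\<^sub>M lborel)"
    by (simp add: lborel_prod borel_measurable_continuous_onI)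
  have "?T -` box l u \<inter> space (lborel \<Otimes>\<^sub>M lborel)
      = {l $ 1<..<u $ 1} \<times> {l $ 2<..<u $ 2} \<times> {l $ 3<..<u $ 3}"
    by (auto simp: mem_box_cart forall_3 space_pair_measure)
  then have "emeasure (distr (lborel \<Otimes>\<^sub>M lborel) borel ?T) (box l u)
      = emeasure (lborel \<Otimes>\<^sub>M (lborel \<Otimes>\<^sub>M lborel)) ({l $ 1<..<u $ 1} \<times> {l $ 2<..<u $ 2} \<times> {l $ 3<..<u $ 3})"
    using T by (simp add: emeasure_distr lborel_prod)
  also have "\<dots> = emeasure lborel {l $ 1<..<u $ 1} * emeasure (lborel \<Otimes>\<^sub>M lborel) ({l $ 2<..<u $ 2} \<times> {l $ 3<..<u $ 3})"
    by (rule sigma_finite_measure.emeasure_pair_measure_Times)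
       (simp_all add: lborel_prod lborel.sigma_finite_measure_axioms borel_open open_Times)
  also have "\<dots> = emeasure lborel {l $ 1<..<u $ 1} * (emeasure lborel {l $ 2<..<u $ 2} * emeasure lborel {l $ 3<..<u $ 3})"
    by (subst lborel.emeasure_pair_measure_Times) auto
  also have "\<dots> = ennreal ((u $ 1 - l $ 1) * ((u $ 2 - l $ 2) * (u $ 3 - l $ 3)))"
    using le' by (simp add: ennreal_mult)
  also have "(u $ 1 - l $ 1) * ((u $ 2 - l $ 2) * (u $ 3 - l $ 3)) = (\<Prod>b\<in>Basis. (u - l) \<bullet> b)"
  proof -
    have "(\<Prod>b\<in>Basis. (u - l) \<bullet> b) = (\<Prod>i\<in>UNIV. (u - l) $ i)"
      by (simp add: Basis_vec_def cart_eq_inner_axis axis_eq_axis prod.UNION_disjoint)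
    also have "\<dots> = (u $ 1 - l $ 1) * ((u $ 2 - l $ 2) * (u $ 3 - l $ 3))"
      unfolding UNIV_3 by (simp add: mult.assoc)
    finally show ?thesis by (rule sym)
  qed
  finally show "emeasure (distr (lborel \<Otimes>\<^sub>M lborel) borel ?T) (box l u) = ennreal (\<Prod>b\<in>Basis. (u - l) \<bullet> b)" .
qed simp

section \<open>Volume in spherical coordinates\<close>

text \<open>Radius and angles are packed into one vector so that the map goes from
  \<open>real^3\<close> to itself and its derivative has a determinant.\<close>

definition spherical_coords :: "real^3 \<Rightarrow> real^3" where
  "spherical_coords v = v $ 1 *\<^sub>R sphere_param (v $ 2, v $ 3)"

text \<open>Radius 0 and the extreme angles are left out to make \<open>spherical_coords\<close>
  injective; what its image then misses of the unit ball lies in the plane where the second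
  coordinate vanishes.\<close>

definition spherical_box :: "(real^3) set" where
  "spherical_box = {v. 0 < v $ 1 \<and> v $ 1 \<le> 1 \<and> 0 < v $ 2 \<and> v $ 2 < pi \<and> 0 < v $ 3 \<and> v $ 3 < 2 * pi}"

lemma spherical_coords_eq:
  "spherical_coords v = vector [v $ 1 * (sin (v $ 2) * cos (v $ 3)), v $ 1 * (sin (v $ 2) * sin (v $ 3)), v $ 1 * cos (v $ 2)]"
  by (simp add: spherical_coords_def sphere_param_def vec_eq_iff forall_3)

lemma norm_spherical_coords: "norm (spherical_coords v) = \<bar>v $ 1\<bar>"
  by (simp add: spherical_coords_def)

lemma spherical_coords_deriv:
  "\<exists>f'. (spherical_coords has_derivative f') (at v within S) \<and> det (matrix f') = (v $ 1)\<^sup>2 * sin (v $ 2)"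
proof -
  have nth: "((\<lambda>v::real^3. v $ i) has_derivative (\<lambda>h. h $ i)) (at v within S)" for i
    by (rule bounded_linear_imp_has_derivative) (rule bounded_linear_vec_nth)
  let ?r = "v $ 1" and ?t = "v $ 2" and ?p = "v $ 3"
  let ?f' = "\<lambda>h :: real^3. vector [h $ 1 * sin ?t * cos ?p + ?r * cos ?t * cos ?p * h $ 2 - ?r * sin ?t * sin ?p * h $ 3,
    h $ 1 * sin ?t * sin ?p + ?r * cos ?t * sin ?p * h $ 2 + ?r * sin ?t * cos ?p * h $ 3,
    h $ 1 * cos ?t - ?r * sin ?t * h $ 2] :: real^3"
  have "(spherical_coords has_derivative ?f') (at v within S)"
    unfolding spherical_coords_eq
  proof (rule has_derivative_vector3)
    note [derivative_intros] = nth
    show "((\<lambda>v. v $ 1 * (sin (v $ 2) * cos (v $ 3))) has_derivative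
      (\<lambda>h. h $ 1 * sin ?t * cos ?p + ?r * cos ?t * cos ?p * h $ 2 - ?r * sin ?t * sin ?p * h $ 3)) (at v within S)"
      by (rule has_derivative_eq_rhs, (rule derivative_intros)+) (simp add: fun_eq_iff algebra_simps)
    show "((\<lambda>v. v $ 1 * (sin (v $ 2) * sin (v $ 3))) has_derivative
      (\<lambda>h. h $ 1 * sin ?t * sin ?p + ?r * cos ?t * sin ?p * h $ 2 + ?r * sin ?t * cos ?p * h $ 3)) (at v within S)"
      by (rule has_derivative_eq_rhs, (rule derivative_intros)+) (simp add: fun_eq_iff algebra_simps)
    show "((\<lambda>v. v $ 1 * cos (v $ 2)) has_derivative (\<lambda>h. h $ 1 * cos ?t - ?r * sin ?t * h $ 2)) (at v within S)"
      by (rule has_derivative_eq_rhs, (rule derivative_intros)+) (simp add: fun_eq_iff algebra_simps)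
  qed
  moreover have "det (matrix ?f') = ?r\<^sup>2 * sin ?t * ((sin ?t)\<^sup>2 + (cos ?t)\<^sup>2) * ((sin ?p)\<^sup>2 + (cos ?p)\<^sup>2)"
  proof -
    have "det (matrix ?f') = sin ?t * cos ?p * (?r * cos ?t * sin ?p) * 0
      + (?r * cos ?t * cos ?p) * (?r * sin ?t * cos ?p) * cos ?t
      + (- (?r * sin ?t * sin ?p)) * (sin ?t * sin ?p) * (- (?r * sin ?t))
      - sin ?t * cos ?p * (?r * sin ?t * cos ?p) * (- (?r * sin ?t))
      - (?r * cos ?t * cos ?p) * (sin ?t * sin ?p) * 0
      - (- (?r * sin ?t * sin ?p)) * (?r * cos ?t * sin ?p) * cos ?t"
      unfolding det_3 matrix_def by (simp only: vec_lambda_beta vector_3) (simp add: axis_def)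
    moreover have "st * cp * (r * ct * sp) * 0 + (r * ct * cp) * (r * st * cp) * ct
      + (- (r * st * sp)) * (st * sp) * (- (r * st)) - st * cp * (r * st * cp) * (- (r * st))
      - (r * ct * cp) * (st * sp) * 0 - (- (r * st * sp)) * (r * ct * sp) * ct
      = r\<^sup>2 * st * (st\<^sup>2 + ct\<^sup>2) * (sp\<^sup>2 + cp\<^sup>2)" for r st ct sp cp :: real
      by (simp add: algebra_simps power2_eq_square)
    ultimately show ?thesis by (simp only:)
  qed
  ultimately show ?thesis by auto
qed

lemma inj_on_spherical_coords: "inj_on spherical_coords spherical_box"
proof (rule inj_onI)
  fix v w assume v: "v \<in> spherical_box" and w: "w \<in> spherical_box" and eq: "spherical_coords v = spherical_coords w"
  have 1: "v $ 1 = w $ 1"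
    using arg_cong[OF eq, of norm] v w by (simp add: norm_spherical_coords spherical_box_def)
  have "v $ 1 > 0" using v by (simp add: spherical_box_def)
  then have e: "sphere_param (v $ 2, v $ 3) = sphere_param (w $ 2, w $ 3)"
    using eq 1 by (simp add: spherical_coords_def)
  from arg_cong[OF this, of "\<lambda>x. x $ 3"] have "cos (v $ 2) = cos (w $ 2)"
    by (simp add: sphere_param_def)
  then have 2: "v $ 2 = w $ 2"
    using v w unfolding spherical_box_def by - (rule cos_inj_pi, simp_all)
  have "sin (w $ 2) > 0" using w unfolding spherical_box_def by (intro sin_gt_zero) simp_all
  then have "sin (v $ 3) = sin (w $ 3) \<and> cos (v $ 3) = cos (w $ 3)"
    using arg_cong[OF e, of "\<lambda>x. x $ 1"] arg_cong[OF e, of "\<lambda>x. x $ 2"] unfolding 2 by (simp add: sphere_param_def)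
  then obtain n :: int where n: "v $ 3 = w $ 3 + 2 * pi * n" using sin_cos_eq_iff[of "v $ 3" "w $ 3"] by auto
  have "\<bar>2 * pi * n\<bar> < 2 * pi" using v w n by (auto simp: spherical_box_def)
  then have "\<bar>real_of_int n\<bar> < 1" by (simp add: abs_mult)
  then have "n = 0" by linarith
  then show "v = w" using 1 2 n by (simp add: vec_eq_iff forall_3)
qed

lemma spherical_coords_surj:
  assumes "norm x \<le> 1" "x $ 2 \<noteq> 0"
  shows "\<exists>v \<in> spherical_box. spherical_coords v = x"
proof -
  have x0: "x \<noteq> 0" using assms(2) by auto
  define r where "r = norm x"
  have r: "0 < r" "r \<le> 1" using x0 assms by (auto simp: r_def)
  have n2: "r\<^sup>2 = (x $ 1)\<^sup>2 + (x $ 2)\<^sup>2 + (x $ 3)\<^sup>2"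
    unfolding r_def by (rule power2_norm_vec3)
  define z where "z = Complex (x $ 1) (x $ 2)"
  have z0: "z \<noteq> 0" using assms(2) by (auto simp: z_def complex_eq_iff)
  have z2: "(cmod z)\<^sup>2 = r\<^sup>2 - (x $ 3)\<^sup>2" by (simp add: n2 z_def cmod_power2)
  have zpos: "cmod z > 0" using z0 by simp
  have "(x $ 3)\<^sup>2 < r\<^sup>2" using z2 zero_less_power[OF zpos, of 2] by linarith
  then have x3: "\<bar>x $ 3\<bar> < r" using r abs_le_square_iff[of r "x $ 3"] by auto
  define t where "t = arccos (x $ 3 / r)"
  have "-1 < x $ 3 / r" "x $ 3 / r < 1" using x3 r by (auto simp: field_simps)
  then have t: "0 < t" "t < pi" and ct: "cos t = x $ 3 / r"
    using arccos_lt_bounded[of "x $ 3 / r"] by (auto simp: t_def)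
  have "(r * sin t)\<^sup>2 = (cmod z)\<^sup>2"
    unfolding z2 power_mult_distrib sin_squared_eq ct using r by (simp add: field_simps)
  moreover have "r * sin t > 0" using r sin_gt_zero[OF t] by simp
  ultimately have st: "r * sin t = cmod z" using zpos by (simp add: power2_eq_iff_nonneg)
  \<comment> \<open>The box wants azimuths in (0, 2\<pi>), hence \<open>Arg2pi\<close>; the value 0
    is excluded by the nonzero second coordinate.\<close>
  define p where "p = Arg2pi z"
  have "p \<noteq> 0"
  proof
    assume "p = 0"
    then have "z \<in> \<real>" by (simp add: p_def Arg2pi_eq_0)
    then show False using assms(2) by (simp add: z_def complex_is_Real_iff)
  qed
  then have p: "0 < p" "p < 2 * pi" using Arg2pi_ge_0[of z] Arg2pi_lt_2pi[of z] by (auto simp: p_def)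
  have "z = of_real (cmod z) * cis p" using Arg2pi_eq[of z] by (simp add: p_def cis_conv_exp)
  then have "cmod z * cos p = x $ 1" "cmod z * sin p = x $ 2"
    by (simp_all add: z_def complex_eq_iff)
  then have "spherical_coords (vector [r, t, p]) = x"
    using st ct r by (simp add: spherical_coords_eq vec_eq_iff forall_3 mult.assoc[symmetric])
  moreover have "vector [r, t, p] \<in> spherical_box" using r t p by (simp add: spherical_box_def)
  ultimately show ?thesis by blast
qed

lemma sphere_density_nonneg: "0 \<le> indicator ({0..pi} \<times> {0..2 * pi}) p * sin (fst p)"
  by (auto simp: indicator_def split_beta intro: sin_ge_zero)

lemma measurable_sphere_density [measurable]:
  "(\<lambda>p. indicator ({0..pi} \<times> {0..2 * pi}) p * sin (fst p)) \<in> borel_measurable (borel :: (real \<times> real) measure)"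
proof -
  have "{0..pi} \<times> {0..2 * pi} \<in> sets (borel :: (real \<times> real) measure)"
    by (intro borel_closed closed_Times closed_atLeastAtMost)
  moreover have "(\<lambda>p. sin (fst p)) \<in> borel_measurable (borel :: (real \<times> real) measure)"
    by (intro borel_measurable_continuous_onI continuous_intros)
  ultimately show ?thesis by measurable
qed

lemma sphere_measure_alt:
  "sphere_measure = distr (density lborel (\<lambda>p. ennreal (indicator ({0..pi} \<times> {0..2 * pi}) p * sin (fst p)))) borel sphere_param"
  unfolding sphere_measure_def by (simp add: split_beta')

lemma sets_sphere_measure [simp, measurable_cong]: "sets sphere_measure = sets borel"
  by (simp add: sphere_measure_alt)

lemma space_sphere_measure [simp]: "space sphere_measure = UNIV"
  by (simp add: sphere_measure_alt)

lemma emeasure_sphere_measure: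
  assumes [measurable]: "A \<in> sets borel"
  shows "emeasure sphere_measure A
    = (\<integral>\<^sup>+p. ennreal (indicator ({0..pi} \<times> {0..2 * pi}) p * sin (fst p)) * indicator A (sphere_param p) \<partial>lborel)"
proof -
  have "sphere_param -` A \<in> sets borel"
    using measurable_sets[OF measurable_sphere_param assms] by simp
  then show ?thesis unfolding sphere_measure_alt
    by (simp add: emeasure_distr emeasure_density) (simp add: indicator_def vimage_def)
qed

lemma finite_measure_sphere_measure: "finite_measure sphere_measure"
proof
  have "emeasure sphere_measure UNIV \<le> (\<integral>\<^sup>+p. indicator (cbox (0, 0) (pi, 2 * pi)) p \<partial>lborel)"
    by (subst emeasure_sphere_measure)
       (auto intro!: nn_integral_mono simp: indicator_def cbox_Pair_eq)
  also have "\<dots> < \<infinity>" by (simp add: emeasure_lborel_cbox_finite[unfolded infinity_ennreal_def])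
  finally show "emeasure sphere_measure (space sphere_measure) \<noteq> \<infinity>" by simp
qed

interpretation sphere_measure: finite_measure sphere_measure
  by (rule finite_measure_sphere_measure)

text \<open>Bridges the closed parameter rectangle of \<open>sphere_measure\<close> and the open one
  of \<open>spherical_box\<close>: they differ by a null set.\<close>

lemma AE_sphere_box:
  "AE p in lborel. p \<in> {0..pi} \<times> {0..2 * pi} \<longrightarrow> p \<in> {0<..<pi} \<times> {0<..<2 * pi}"
proof -
  let ?N = "cbox (0, 0) (pi, 2 * pi) - box (0, 0) (pi, 2 * pi)"
  have "?N \<in> null_sets lebesgue"
    using negligible_frontier_interval negligible_iff_null_sets by blast
  moreover have "?N \<in> sets lborel" by simp
  ultimately have "?N \<in> null_sets lborel"
    using null_sets_completion_iff by blast
  then have "AE p in lborel. p \<notin> ?N" by (rule AE_not_in)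
  then show ?thesis
    by eventually_elim (auto simp: cbox_Pair_eq box_prod)
qed

lemma nn_integral_square_unit: "(\<integral>\<^sup>+r. ennreal (indicator {0<..1} r * r\<^sup>2) \<partial>lborel) = ennreal (1 / 3)"
proof -
  have "(\<integral>\<^sup>+r. ennreal (indicator {0<..1} r * r\<^sup>2) \<partial>lborel) = (\<integral>\<^sup>+r. ennreal (r\<^sup>2) * indicator {0..1} r \<partial>lborel)"
    by (intro nn_integral_cong) (auto simp: indicator_def)
  also have "\<dots> = ennreal (1 ^ 3 / 3 - 0 ^ 3 / 3)"
    by (rule nn_integral_FTC_Icc) (auto intro!: derivative_eq_intros)
  finally show ?thesis by simp
qed

text \<open>The integrand is the Jacobian over the coordinates of a cone. It factors into a radial
  part, with integral 1/3, and the angular density that defines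
  \<open>sphere_measure\<close>.\<close>

lemma nn_integral_spherical:
  assumes [measurable]: "A \<in> sets borel"
  defines "S \<equiv> {v \<in> spherical_box. sphere_param (v $ 2, v $ 3) \<in> A}"
  shows "S \<in> sets borel"
    and "(\<integral>\<^sup>+v. ennreal (indicator S v * ((v $ 1)\<^sup>2 * sin (v $ 2))) \<partial>lborel) = ennreal (1 / 3) * emeasure sphere_measure A"
proof -
  have [measurable]: "(\<lambda>v::real^3. sphere_param (v $ 2, v $ 3)) \<in> borel_measurable borel"
    by (intro borel_measurable_continuous_onI continuous_on_compose2[OF continuous_on_sphere_param[of UNIV]] continuous_intros) auto
  have "S = {v \<in> space borel. 0 < v $ 1 \<and> v $ 1 \<le> 1 \<and> 0 < v $ 2 \<and> v $ 2 < pi \<and> 0 < v $ 3 \<and> v $ 3 < 2 * pi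
      \<and> sphere_param (v $ 2, v $ 3) \<in> A}"
    by (auto simp: S_def spherical_box_def)
  also have "\<dots> \<in> sets borel" by measurable
  finally show S [measurable]: "S \<in> sets borel" .
  let ?T = "\<lambda>(r, p). vector [r, fst p, snd p] :: real^3"
  let ?h = "\<lambda>v :: real^3. ennreal (indicator S v * ((v $ 1)\<^sup>2 * sin (v $ 2)))"
  let ?q = "\<lambda>p. ennreal (indicator ({0..pi} \<times> {0..2 * pi}) p * sin (fst p)) * indicator A (sphere_param p)"
  let ?q' = "\<lambda>p. ennreal (indicator ({0<..<pi} \<times> {0<..<2 * pi}) p * sin (fst p)) * indicator A (sphere_param p)"
  have h [measurable]: "?h \<in> borel_measurable borel" by measurable
  have "continuous_on UNIV ?T" unfolding split_beta by (intro continuous_intros)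
  then have T: "?T \<in> measurable (lborel \<Otimes>\<^sub>M lborel) borel"
    by (simp add: lborel_prod borel_measurable_continuous_onI)
  have hT: "(\<lambda>x. ?h (?T x)) \<in> borel_measurable (lborel \<Otimes>\<^sub>M lborel)"
    by (rule measurable_compose[OF T h])
  have q [measurable]: "?q \<in> borel_measurable lborel" by measurable
  have "(\<integral>\<^sup>+v. ?h v \<partial>lborel) = (\<integral>\<^sup>+x. ?h (?T x) \<partial>(lborel \<Otimes>\<^sub>M lborel))"
    by (subst distr_lborel_vector3[symmetric]) (rule nn_integral_distr[OF T], simp)
  also have "\<dots> = (\<integral>\<^sup>+r. \<integral>\<^sup>+p. ?h (?T (r, p)) \<partial>lborel \<partial>lborel)"
    by (rule lborel.nn_integral_fst[OF hT, symmetric])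
  also have "\<dots> = (\<integral>\<^sup>+r. \<integral>\<^sup>+p. ennreal (indicator {0<..1} r * r\<^sup>2) * ?q' p \<partial>lborel \<partial>lborel)"
    by (intro nn_integral_cong)
       (auto simp: S_def spherical_box_def indicator_def ennreal_mult[symmetric] sin_ge_zero)
  also have "\<dots> = (\<integral>\<^sup>+r. \<integral>\<^sup>+p. ennreal (indicator {0<..1} r * r\<^sup>2) * ?q p \<partial>lborel \<partial>lborel)"
  proof (rule nn_integral_cong, rule nn_integral_cong_AE)
    fix r :: real
    show "AE p in lborel. ennreal (indicator {0<..1} r * r\<^sup>2) * ?q' p = ennreal (indicator {0<..1} r * r\<^sup>2) * ?q p"
      using AE_sphere_box by eventually_elim (auto simp: indicator_def)
  qed
  also have "\<dots> = (\<integral>\<^sup>+r. ennreal (indicator {0<..1} r * r\<^sup>2) * emeasure sphere_measure A \<partial>lborel)"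
    using q by (simp add: nn_integral_cmult emeasure_sphere_measure)
  also have "\<dots> = ennreal (1 / 3) * emeasure sphere_measure A"
    by (subst nn_integral_multc) (simp_all add: nn_integral_square_unit)
  finally show "(\<integral>\<^sup>+v. ?h v \<partial>lborel) = ennreal (1 / 3) * emeasure sphere_measure A" .
qed

text \<open>Change of variables expresses the surface measure by Lebesgue measure, where invariance
  under orthogonal maps is at hand. The image of the coordinate set is the cone up to a null
  set.\<close>

lemma measure_cone:
  assumes A: "A \<in> sets borel"
  defines "C \<equiv> {x \<in> cball 0 1. x \<noteq> 0 \<and> x /\<^sub>R norm x \<in> A}"
  shows "C \<in> lmeasurable" and "measure lebesgue C = measure sphere_measure A / 3"
proof -
  define S where "S = {v \<in> spherical_box. sphere_param (v $ 2, v $ 3) \<in> A}"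
  note S = nn_integral_spherical[OF A, folded S_def]
  have sin: "0 \<le> sin (v $ 2)" if "v \<in> S" for v
    using that by (auto simp: S_def spherical_box_def intro: sin_ge_zero)
  have "((\<lambda>v. indicator S v * ((v $ 1)\<^sup>2 * sin (v $ 2))) has_integral (measure sphere_measure A / 3)) UNIV"
  proof (rule nn_integral_has_integral)
    show "(\<lambda>v. indicator S v * ((v $ 1)\<^sup>2 * sin (v $ 2))) \<in> borel_measurable borel"
      using S(1) by measurable
    show "(\<integral>\<^sup>+v. ennreal (indicator S v * ((v $ 1)\<^sup>2 * sin (v $ 2))) \<partial>lborel) = ennreal (measure sphere_measure A / 3)"
      unfolding S(2) by (simp add: sphere_measure.emeasure_eq_measure ennreal_mult[symmetric])
  qed (auto simp: indicator_def sin)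
  then have int0: "((\<lambda>v. (v $ 1)\<^sup>2 * sin (v $ 2)) has_integral (measure sphere_measure A / 3)) S"
  proof (subst has_integral_restrict_UNIV[symmetric], rule has_integral_eq[rotated])
  qed (simp add: indicator_def)
  have "\<exists>f'. \<forall>v. (spherical_coords has_derivative f' v) (at v within S)
      \<and> det (matrix (f' v)) = (v $ 1)\<^sup>2 * sin (v $ 2)"
    by (intro choice allI spherical_coords_deriv)
  then obtain f' where f': "\<And>v. (spherical_coords has_derivative f' v) (at v within S)"
    "\<And>v. det (matrix (f' v)) = (v $ 1)\<^sup>2 * sin (v $ 2)"
    by blast
  have int: "((\<lambda>v. \<bar>det (matrix (f' v))\<bar>) has_integral (measure sphere_measure A / 3)) S"
    by (rule has_integral_eq[OF _ int0]) (simp add: f' sin)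
  have "S \<in> sets lebesgue" using S(1) by (simp add: sets_completionI_sets)
  moreover have "inj_on spherical_coords S"
    by (rule inj_on_subset[OF inj_on_spherical_coords]) (auto simp: S_def)
  ultimately have im: "spherical_coords ` S \<in> lmeasurable" "measure lebesgue (spherical_coords ` S) = measure sphere_measure A / 3"
    using has_measure_differentiable_image[OF _ f'(1), of "measure sphere_measure A / 3"] int by blast+
  have dir: "spherical_coords v /\<^sub>R norm (spherical_coords v) = sphere_param (v $ 2, v $ 3)" "spherical_coords v \<noteq> 0" "norm (spherical_coords v) \<le> 1"
    if "v \<in> spherical_box" for v
  proof -
    have v: "0 < v $ 1" "v $ 1 \<le> 1" using that by (auto simp: spherical_box_def)
    then have n: "norm (spherical_coords v) = v $ 1" by (simp add: norm_spherical_coords)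
    show "spherical_coords v /\<^sub>R norm (spherical_coords v) = sphere_param (v $ 2, v $ 3)"
      unfolding n using v by (simp add: spherical_coords_def)
    show "spherical_coords v \<noteq> 0" "norm (spherical_coords v) \<le> 1" using n v by auto
  qed
  have 1: "spherical_coords ` S \<subseteq> C"
    using dir by (auto simp: S_def C_def)
  \<comment> \<open>Only points with vanishing second coordinate can be missed, by surjectivity
    elsewhere.\<close>
  have 2: "C - spherical_coords ` S \<subseteq> {x. axis 2 1 \<bullet> x = 0}"
  proof
    fix x assume x: "x \<in> C - spherical_coords ` S"
    show "x \<in> {x. axis 2 1 \<bullet> x = 0}"
    proof (rule ccontr)
      assume "x \<notin> {x. axis 2 1 \<bullet> x = 0}"
      then have "x $ 2 \<noteq> 0" by (simp add: inner_axis')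
      then obtain v where "v \<in> spherical_box" "spherical_coords v = x"
        using spherical_coords_surj[of x] x by (auto simp: C_def)
      then show False using x dir(1)[of v] by (auto simp: S_def C_def)
    qed
  qed
  have null: "negligible {x :: real^3. axis 2 1 \<bullet> x = 0}"
    by (rule negligible_hyperplane) (simp add: axis_eq_0_iff)
  have neg: "negligible (spherical_coords ` S - C \<union> (C - spherical_coords ` S))"
    by (rule negligible_subset[OF null]) (use 1 2 in blast)
  show "C \<in> lmeasurable"
    by (rule lmeasurable_negligible_symdiff[OF im(1) neg])
  show "measure lebesgue C = measure sphere_measure A / 3"
    using measure_negligible_symdiff[OF im(1) neg] im(2) by simp
qed

lemma distr_sphere_measure_orthogonal:
  fixes R :: "real^3 \<Rightarrow> real^3"
  assumes R: "orthogonal_transformation R"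
  shows "distr sphere_measure borel R = sphere_measure"
proof (rule measure_eqI)
  have lin: "linear R" and nrm: "\<And>x. norm (R x) = norm x"
    using R by (auto simp: orthogonal_transformation_linear orthogonal_transformation_norm)
  have "continuous_on UNIV R" by (rule linear_continuous_on) (simp add: lin linear_conv_bounded_linear[symmetric])
  then have Rm [measurable]: "R \<in> borel_measurable borel" by (rule borel_measurable_continuous_onI)
  fix A assume "A \<in> sets (distr sphere_measure borel R)"
  then have A [measurable]: "A \<in> sets borel" by simp
  define C where "C = (\<lambda>A. {x \<in> cball 0 1. x \<noteq> 0 \<and> x /\<^sub>R norm x \<in> (A :: (real^3) set)})"
  have RA: "R -` A \<in> sets borel" using measurable_sets[OF Rm A] by simp
  have "C A = R ` C (R -` A)"
  proof (intro equalityI subsetI)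
    fix y assume y: "y \<in> C A"
    obtain x where x: "y = R x" using orthogonal_transformation_surj[OF R] by (metis surjD)
    have "x \<in> C (R -` A)"
      using y nrm[of x] lin by (auto simp: C_def x linear_cmul linear_0)
    then show "y \<in> R ` C (R -` A)" using x by blast
  next
    fix y assume "y \<in> R ` C (R -` A)"
    then obtain x where x: "y = R x" "x \<in> C (R -` A)" by blast
    then have "norm (R x) \<noteq> 0" using nrm[of x] by (auto simp: C_def)
    then show "y \<in> C A" using x nrm[of x] lin by (auto simp: C_def linear_cmul)
  qed
  then have "measure lebesgue (C A) = measure lebesgue (C (R -` A))"
    using measure_orthogonal_image[OF R] measure_cone(1)[OF RA] unfolding C_def by simp
  then have "measure sphere_measure A = measure sphere_measure (R -` A)"
    using measure_cone(2)[OF RA] measure_cone(2)[OF A] unfolding C_def by simp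
  then show "emeasure (distr sphere_measure borel R) A = emeasure sphere_measure A"
    by (simp add: emeasure_distr sphere_measure.emeasure_eq_measure)
qed (simp only: sets_distr sets_sphere_measure)

section \<open>Spherical harmonics\<close>

lemma map_poly_of_real_mult:
  "map_poly complex_of_real (p * q) = map_poly complex_of_real p * map_poly complex_of_real q"
  by (intro poly_eqI) (simp add: coeff_map_poly coeff_mult)

lemma pderiv_map_poly_of_real:
  "pderiv (map_poly complex_of_real p) = map_poly complex_of_real (pderiv p)"
  by (intro poly_eqI) (simp add: coeff_pderiv coeff_map_poly)

lemma higher_pderiv_map_poly_of_real:
  "(pderiv ^^ i) (map_poly complex_of_real p) = map_poly complex_of_real ((pderiv ^^ i) p)"
  by (induction i) (simp_all add: pderiv_map_poly_of_real)

lemma poly_map_poly_of_real: "poly (map_poly complex_of_real p) (of_real x) = of_real (poly p x)"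
  by (induction p) (auto simp: map_poly_pCons)

lemma higher_pderiv_pcompose_affine:
  fixes p :: "complex poly"
  shows "(pderiv ^^ i) (p \<circ>\<^sub>p [:a, c:]) = smult (c ^ i) (((pderiv ^^ i) p) \<circ>\<^sub>p [:a, c:])"
  by (induction i) (simp_all add: pderiv_smult pderiv_pcompose pderiv_pCons mult.commute)

lemma pcompose_power: "(p ^ n) \<circ>\<^sub>p q = (p \<circ>\<^sub>p q) ^ n" for p q :: "complex poly"
  by (induction n) (simp_all add: pcompose_mult pcompose_1)

text \<open>Taylor's formula at \<open>a\<close>; it turns coefficients of a power of a quadratic
  into the derivatives in Rodrigues' formula.\<close>

lemma coeff_pcompose_affine:
  fixes p :: "complex poly"
  shows "coeff (p \<circ>\<^sub>p [:a, c:]) i = c ^ i * poly ((pderiv ^^ i) p) a / fact i"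
proof -
  have "fact i * coeff (p \<circ>\<^sub>p [:a, c:]) i = coeff ((pderiv ^^ i) (p \<circ>\<^sub>p [:a, c:])) 0"
    by (simp add: coeff_higher_pderiv pochhammer_fact)
  also have "\<dots> = c ^ i * poly ((pderiv ^^ i) p) a"
    unfolding higher_pderiv_pcompose_affine by (simp add: poly_0_coeff_0[symmetric] poly_pcompose)
  finally show ?thesis by (simp add: field_simps)
qed

lemma degree_quadratic_power: "degree ([:a, b, c:] ^ n) \<le> 2 * n"
  by (rule order_trans[OF degree_power_le]) (simp add: mult_le_mono1)

text \<open>Completing the square turns the quadratic into \<open>(x\<^sup>2 - 1)\<close> after an affine substitution, so that
  its powers are governed by Rodrigues' formula.\<close>

lemma coeff_quadratic_power:
  fixes a c \<mu> :: complex and t :: real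
  assumes ac: "a * c = (of_real t ^ 2 - 1) * \<mu>\<^sup>2" and m: "m \<le> n" "\<mu> \<noteq> 0 \<or> m = 0"
  shows "coeff ([:a, 2 * of_real t * \<mu>, c:] ^ n) (n + m)
    = c ^ m * \<mu> ^ (n - m) * of_real (poly ((pderiv ^^ (n + m)) ([:-1, 0, 1:] ^ n)) t) / fact (n + m)"
proof -
  let ?R = "[:-1, 0, 1:] :: real poly"
  define P where "P = [:a, 2 * of_real t * \<mu>, c:] ^ n"
  have legn: "poly ((pderiv ^^ n) (?R ^ n)) t / fact n = 2 ^ n * poly (legendre_poly n) t"
    by (simp add: legendre_poly_def)
  \<comment> \<open>The affine substitution needs both \<open>c\<close> and \<open>\<mu>\<close>
    nonzero. \<open>c = 0\<close> occurs for harmonics on the polar axis: the base is then linear,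
    so its power has too small a degree unless \<open>m = 0\<close>. \<open>\<mu> = 0\<close> can
    occur in Laplace's integral: the base is then a monomial of degree 0 or 2.\<close>
  consider "c \<noteq> 0" "\<mu> \<noteq> 0" | "c = 0" "m > 0" | "\<mu> = 0" "m = 0" | "c = 0" "m = 0" "\<mu> \<noteq> 0"
    using m by auto
  then show ?thesis
  proof cases
    case 1
    let ?q = "[:of_real t, c / \<mu>:]"
    have mp: "map_poly complex_of_real ?R = [:-1, 0, 1:]" by (simp add: map_poly_pCons)
    have mpp: "map_poly complex_of_real (?R ^ n) = [:-1, 0, 1:] ^ n"
      by (induction n) (simp_all add: map_poly_of_real_mult mp del: mult_pCons_left)
    have "[:-1, 0, 1:] \<circ>\<^sub>p ?q = smult (c / \<mu>\<^sup>2) [:a, 2 * of_real t * \<mu>, c:]"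
    proof -
      have "c / \<mu>\<^sup>2 * a = of_real t ^ 2 - 1" using ac 1 by (simp add: field_simps)
      then show ?thesis using 1 by (simp add: pcompose_pCons power2_eq_square)
    qed
    note q = this
    have "map_poly complex_of_real (?R ^ n) \<circ>\<^sub>p ?q = smult ((c / \<mu>\<^sup>2) ^ n) P"
      unfolding mpp pcompose_power P_def q smult_power ..
    then have "(c / \<mu>\<^sup>2) ^ n * coeff P (n + m) = coeff (map_poly complex_of_real (?R ^ n) \<circ>\<^sub>p ?q) (n + m)"
      by simp
    also have "\<dots> = (c / \<mu>) ^ (n + m) * of_real (poly ((pderiv ^^ (n + m)) (?R ^ n)) t) / fact (n + m)"
      unfolding coeff_pcompose_affine higher_pderiv_map_poly_of_real poly_map_poly_of_real ..
    also have "(c / \<mu>) ^ (n + m) = (c / \<mu>\<^sup>2) ^ n * (c ^ m * \<mu> ^ (n - m))"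
    proof -
      have "\<mu> ^ n = \<mu> ^ (n - m) * \<mu> ^ m" using m by (simp flip: power_add)
      then show ?thesis using 1 by (simp add: power_add power_divide power2_eq_square power_mult_distrib)
    qed
    finally have "(c / \<mu>\<^sup>2) ^ n * coeff P (n + m) = (c / \<mu>\<^sup>2) ^ n * (c ^ m * \<mu> ^ (n - m)
        * of_real (poly ((pderiv ^^ (n + m)) (?R ^ n)) t) / fact (n + m))"
      by (simp only: mult.assoc times_divide_eq_right)
    moreover have "(c / \<mu>\<^sup>2) ^ n \<noteq> 0" using 1 by simp
    ultimately show ?thesis unfolding P_def by (metis mult_left_cancel)
  next
    case 2
    have "degree P \<le> n"
      unfolding P_def by (rule order_trans[OF degree_power_le]) (use 2 in simp)
    then have "coeff P (n + m) = 0" using 2 by (intro coeff_eq_0) simp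
    then show ?thesis using 2 by (simp add: P_def)
  next
    case 3
    show ?thesis
    proof (cases n)
      case 0
      then show ?thesis using 3 by simp
    next
      case (Suc l)
      have "a = 0 \<or> c = 0" using ac 3 by simp
      then have "[:a, 2 * of_real t * \<mu>, c:] = monom c 2 \<or> [:a, 2 * of_real t * \<mu>, c:] = monom a 0"
        using 3 by (auto simp: monom_Suc numeral_2_eq_2 monom_0)
      then have "P = monom c 2 ^ n \<or> P = monom a 0 ^ n" unfolding P_def by metis
      then have "coeff P n = 0" using Suc by (elim disjE) (simp_all only: monom_power coeff_monom, simp_all)
      then show ?thesis using 3 Suc by (simp add: P_def)
    qed
  next
    case 4
    then have t: "t\<^sup>2 = 1"
      using ac by (simp flip: of_real_power add: of_real_eq_1_iff)
    have co: "coeff ([:a, b:] ^ n) n = b ^ n" for b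
    proof (induction n)
      case (Suc n)
      have "degree ([:a, b:] ^ n) < Suc n"
        by (rule le_less_trans[OF degree_power_le]) simp
      then have "coeff ([:a, b:] ^ n) (Suc n) = 0" by (rule coeff_eq_0)
      then show ?case using Suc by simp
    qed simp
    have leg: "of_real (poly ((pderiv ^^ n) (?R ^ n)) t) / (fact n :: complex) = of_real (2 ^ n * t ^ n)"
      using legn poly_legendre_at_endpoint[OF t, of n] by (metis of_real_divide of_real_fact)
    have "coeff ([:a, 2 * of_real t * \<mu>, c:] ^ n) (n + m) = (2 * of_real t * \<mu>) ^ n"
      using co 4 by simp
    also have "\<dots> = \<mu> ^ n * of_real (2 ^ n * t ^ n)" by (simp add: power_mult_distrib mult_ac)
    also have "\<dots> = \<mu> ^ n * (of_real (poly ((pderiv ^^ n) (?R ^ n)) t) / fact n)" by (simp only: leg)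
    finally show ?thesis using 4 by simp
  qed
qed

text \<open>The middle coefficient with \<open>\<mu> = A / 2\<close>. Isotropy turns the product of
  the outer coefficients into \<open>(t^2 - 1) \<mu>^2\<close>, and the powers of 2 from
  \<open>\<mu>\<close> and from Rodrigues' formula cancel.\<close>

lemma coeff_legendre_power:
  fixes A B C :: complex and t s :: real
  assumes "A\<^sup>2 + B\<^sup>2 + C\<^sup>2 = 0" "t\<^sup>2 + s\<^sup>2 = 1"
  shows "coeff ([:of_real s * (B + \<i> * C) / 2, of_real t * A, of_real s * (B - \<i> * C) / 2:] ^ n) n
    = of_real (poly (legendre_poly n) t) * A ^ n"
proof -
  have s2: "s\<^sup>2 = 1 - t\<^sup>2" using assms(2) by simp
  have "complex_of_real s ^ 2 = 1 - of_real t ^ 2"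
    unfolding of_real_power[symmetric] s2 by simp
  note sc = this
  have bc: "B\<^sup>2 + C\<^sup>2 = - A\<^sup>2" using assms(1) by algebra
  have "of_real s * (B + \<i> * C) / 2 * (of_real s * (B - \<i> * C) / 2) = of_real s ^ 2 * (B\<^sup>2 + C\<^sup>2) / 4"
    by (simp add: algebra_simps power2_eq_square)
  then have "of_real s * (B + \<i> * C) / 2 * (of_real s * (B - \<i> * C) / 2) = (of_real t ^ 2 - 1) * (A / 2)\<^sup>2"
    unfolding sc bc by (simp add: power_divide algebra_simps)
  from coeff_quadratic_power[OF this, of 0 n] show ?thesis
    by (simp add: legendre_poly_def power_divide)
qed

text \<open>Laplace's integral for the Legendre polynomial, with an isotropic vector \<open>(A, B, C)\<close> in place
  of \<open>(1, \<i>, 0)\<close>.\<close>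

lemma laplace_integral:
  fixes A B C :: complex and t s :: real
  assumes "A\<^sup>2 + B\<^sup>2 + C\<^sup>2 = 0" "t\<^sup>2 + s\<^sup>2 = 1"
  shows "((\<lambda>\<alpha>. (of_real t * A + of_real s * (of_real (cos \<alpha>) * B + of_real (sin \<alpha>) * C)) ^ n)
    has_integral of_real (2 * pi * poly (legendre_poly n) t) * A ^ n) {0..2 * pi}"
proof -
  define P where "P = [:of_real s * (B + \<i> * C) / 2, of_real t * A, of_real s * (B - \<i> * C) / 2:] ^ n"
  have cis_int: "((\<lambda>\<alpha>. cis (\<alpha> * of_int j)) has_integral (if j = 0 then of_real (2 * pi) else 0)) {0..2 * pi}" for j :: int
  proof (cases "j = 0")
    case True
    then show ?thesis using has_integral_const_real[of "1::complex" 0 "2 * pi"]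
      by (simp add: scaleR_conv_of_real)
  next
    case False
    have "((\<lambda>\<alpha>. exp (\<i> * of_int j * of_real \<alpha>) / (\<i> * of_int j)) has_vector_derivative exp (\<i> * of_int j * of_real \<alpha>)) (at \<alpha> within S)" for \<alpha> S
      by (rule has_vector_derivative_real_field) (use False in \<open>auto intro!: derivative_eq_intros\<close>)
    then have "((\<lambda>\<alpha>. exp (\<i> * of_int j * of_real \<alpha>)) has_integral
       (exp (\<i> * of_int j * of_real (2 * pi)) / (\<i> * of_int j) - exp (\<i> * of_int j * of_real 0) / (\<i> * of_int j))) {0..2 * pi}"
      by (intro fundamental_theorem_of_calculus) auto
    moreover have "exp (\<i> * of_int j * of_real (2 * pi)) = 1"
      using exp_integer_2pi[of "of_int j"] by (simp add: mult_ac)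
    ultimately show ?thesis using False by (simp add: cis_conv_exp mult_ac)
  qed
  \<comment> \<open>On the unit circle the linear form is \<open>cis (- \<alpha>)\<close> times the
    quadratic at \<open>cis \<alpha>\<close>. In this Fourier expansion only the term
    \<open>i = n\<close> has a nonzero integral.\<close>
  have eq: "(of_real t * A + of_real s * (of_real (cos \<alpha>) * B + of_real (sin \<alpha>) * C)) ^ n
      = (\<Sum>i\<le>2 * n. coeff P i * cis (\<alpha> * of_int (int i - int n)))" for \<alpha>
  proof -
    let ?z = "cis \<alpha>" and ?w = "cis (- \<alpha>)"
    have zw: "?w * ?z = 1" by (simp add: cis_mult)
    have c: "of_real (cos \<alpha>) = (?z + ?w) / 2" "of_real (sin \<alpha>) = \<i> * (?w - ?z) / 2"
      by (simp_all add: complex_eq_iff)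
    have "of_real t * A + of_real s * (of_real (cos \<alpha>) * B + of_real (sin \<alpha>) * C)
      = of_real t * A * (?w * ?z) + of_real s * (B - \<i> * C) / 2 * ?z * (?w * ?z) + of_real s * (B + \<i> * C) / 2 * ?w"
      unfolding c zw by (simp add: algebra_simps add_divide_distrib diff_divide_distrib)
    also have "\<dots> = ?w * poly [:of_real s * (B + \<i> * C) / 2, of_real t * A, of_real s * (B - \<i> * C) / 2:] ?z"
      by (simp add: algebra_simps add_divide_distrib)
    finally have "(of_real t * A + of_real s * (of_real (cos \<alpha>) * B + of_real (sin \<alpha>) * C)) ^ n = ?w ^ n * poly P ?z"
      by (simp add: P_def power_mult_distrib)
    also have "poly P ?z = (\<Sum>i\<le>2 * n. coeff P i * ?z ^ i)"
      using degree_quadratic_power unfolding poly_altdef P_def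
      by (intro sum.mono_neutral_left) (auto simp: coeff_eq_0)
    also have "?w ^ n * \<dots> = (\<Sum>i\<le>2 * n. coeff P i * cis (\<alpha> * of_int (int i - int n)))"
      unfolding sum_distrib_left
      by (intro sum.cong refl) (simp add: Complex.DeMoivre cis_mult algebra_simps)
    finally show ?thesis .
  qed
  have "((\<lambda>\<alpha>. \<Sum>i\<le>2 * n. coeff P i * cis (\<alpha> * of_int (int i - int n))) has_integral
     (\<Sum>i\<le>2 * n. coeff P i * (if int i - int n = 0 then of_real (2 * pi) else 0))) {0..2 * pi}"
    by (intro has_integral_sum has_integral_mult_right cis_int) simp
  also have "(\<Sum>i\<le>2 * n. coeff P i * (if int i - int n = 0 then of_real (2 * pi) else 0))
     = (\<Sum>i\<le>2 * n. if i = n then coeff P i * of_real (2 * pi) else 0)"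
    by (intro sum.cong) auto
  also have "\<dots> = of_real (2 * pi) * coeff P n" by simp
  also have "\<dots> = of_real (2 * pi * poly (legendre_poly n) t) * A ^ n"
    unfolding P_def coeff_legendre_power[OF assms] by simp
  finally show ?thesis unfolding eq .
qed

section \<open>The generating polynomial of the spherical harmonics and their circle means\<close>

definition azimuth_vec :: "real^3 \<Rightarrow> complex" where
  "azimuth_vec y = Complex (y $ 1) (y $ 2)"

text \<open>As a function of \<open>y\<close> the value at \<open>h\<close> is the \<open>n\<close>-th power of the linear form with the isotropic
  coefficient vector \<open>(1 - h\<^sup>2, - \<i> (1 + h\<^sup>2), 2 h)\<close>; its coefficients in \<open>h\<close> are the spherical
  harmonics of order \<open>n\<close>.\<close>

definition harmonic_gen :: "nat \<Rightarrow> real^3 \<Rightarrow> complex poly" where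
  "harmonic_gen n y = [:cnj (azimuth_vec y), 2 * of_real (y $ 3), - azimuth_vec y:] ^ n"

lemma continuous_on_azimuth_vec [continuous_intros]:
  "continuous_on S f \<Longrightarrow> continuous_on S (\<lambda>x. azimuth_vec (f x))"
  unfolding azimuth_vec_def by (intro continuous_intros)

lemma continuous_on_coeff_quadratic_power:
  fixes a b c :: "'a::topological_space \<Rightarrow> complex"
  assumes "continuous_on S a" "continuous_on S b" "continuous_on S c"
  shows "continuous_on S (\<lambda>x. coeff ([:a x, b x, c x:] ^ n) i)"
proof (induction n arbitrary: i)
  case (Suc n)
  have "continuous_on S (\<lambda>x. coeff [:a x, b x, c x:] j)" for j
  proof -
    have "j = 0 \<or> j = 1 \<or> j = 2 \<or> (\<exists>i. j = Suc (Suc (Suc i)))" by presburger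
    then show ?thesis using assms by (auto simp: coeff_pCons numeral_2_eq_2)
  qed
  then show ?case using Suc by (simp only: power_Suc coeff_mult) (intro continuous_intros)
qed simp

lemma continuous_on_coeff_harmonic_gen [continuous_intros]:
  "continuous_on S f \<Longrightarrow> continuous_on S (\<lambda>x. coeff (harmonic_gen n (f x)) i)"
  unfolding harmonic_gen_def by (intro continuous_on_coeff_quadratic_power continuous_intros)

lemma degree_harmonic_gen: "degree (harmonic_gen n y) \<le> 2 * n"
  unfolding harmonic_gen_def by (rule degree_quadratic_power)

text \<open>The square root is the normalisation; \<open>fact (n + m)\<close> undoes the Taylor
  denominator, and the last denominator is that of Rodrigues' formula.\<close>

definition sph_harmonic_const :: "nat \<Rightarrow> nat \<Rightarrow> real" where
  "sph_harmonic_const n m = sqrt ((2 * real n + 1) / (4 * pi) * (fact (n - m) / fact (n + m))) * fact (n + m) / (2 ^ n * fact n)"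

text \<open>The coefficient formula with \<open>\<mu> = 1\<close>. The factor
  \<open>(- azimuth_vec y) ^ m\<close> carries the Condon-Shortley sign, the power of the sine and
  the azimuthal phase together, at the poles too.\<close>

lemma sph_harmonic_eq_coeff:
  assumes y: "y \<in> sphere 0 1" and m: "m \<le> n"
  shows "sph_harmonic n (int m) y = of_real (sph_harmonic_const n m) * coeff (harmonic_gen n y) (n + m)"
proof -
  let ?w = "azimuth_vec y" and ?t = "y $ 3"
  have y1: "(norm y)\<^sup>2 = 1" using y by simp
  have w2: "(cmod ?w)\<^sup>2 = 1 - ?t\<^sup>2"
    using y1 unfolding power2_norm_vec3 by (simp add: azimuth_vec_def cmod_power2)
  then have w: "sqrt (1 - ?t\<^sup>2) = cmod ?w" by (metis norm_ge_zero real_sqrt_unique)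
  have "?t\<^sup>2 \<le> 1" using w2 zero_le_power2[of "cmod ?w"] by linarith
  then have "\<bar>?t\<bar> \<le> 1" by (simp add: abs_square_le_1)
  then have t: "cos (arccos ?t) = ?t" by (intro cos_arccos) auto
  have "cnj ?w * - ?w = - of_real ((cmod ?w)\<^sup>2)"
    unfolding complex_norm_square by (simp add: mult.commute)
  then have "cnj ?w * - ?w = (of_real ?t ^ 2 - 1) * 1\<^sup>2" unfolding w2 by simp
  from coeff_quadratic_power[OF this m]
  have "coeff (harmonic_gen n y) (n + m) = (- ?w) ^ m * of_real (poly ((pderiv ^^ (n + m)) ([:-1, 0, 1:] ^ n)) ?t) / fact (n + m)"
    by (simp add: harmonic_gen_def)
  moreover have "of_real (cmod ?w) ^ m * cis (of_int (int m) * Arg ?w) = ?w ^ m"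
  proof -
    have "?w = of_real (cmod ?w) * cis (Arg ?w)" by (metis rcis_cmod_Arg rcis_def)
    then show ?thesis by (metis of_int_of_nat_eq power_mult_distrib Complex.DeMoivre)
  qed
  moreover have "(pderiv ^^ m) (legendre_poly n) = smult (1 / (2 ^ n * fact n)) ((pderiv ^^ (n + m)) ([:-1, 0, 1:] ^ n))"
    by (simp add: legendre_poly_def pderiv_funpow_smult funpow_add add.commute)
  ultimately show ?thesis
    unfolding sph_harmonic_def sph_harmonic_angles_def assoc_legendre_def sph_harmonic_const_def Let_def t w azimuth_vec_def[symmetric]
    by (simp add: power_minus[of ?w] mult_ac)
qed

lemma sph_harmonic_minus:
  assumes "m > 0"
  shows "sph_harmonic n (- int m) y = (-1) ^ m * cnj (sph_harmonic n (int m) y)"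
  using assms unfolding sph_harmonic_def sph_harmonic_angles_def Let_def
  by (simp add: cis_cnj)

text \<open>An extension is needed because \<open>sph_harmonic\<close> is not continuous off the sphere: on the polar axis
  inside the ball the azimuth is undetermined, but the Legendre factor need not vanish.\<close>

lemma sph_harmonic_continuous:
  assumes "- int n \<le> m" "m \<le> int n"
  shows "\<exists>Y. continuous_on UNIV Y \<and> (\<forall>y \<in> sphere 0 1. sph_harmonic n m y = Y y)"
proof -
  define l where "l = nat \<bar>m\<bar>"
  have l: "l \<le> n" using assms by (auto simp: l_def)
  let ?Y = "\<lambda>y. of_real (sph_harmonic_const n l) * coeff (harmonic_gen n y) (n + l)"
  have Y: "continuous_on UNIV ?Y" by (intro continuous_intros)
  show ?thesis
  proof (cases "m < 0")
    case True
    then have m: "m = - int l" "l > 0" by (auto simp: l_def)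
    show ?thesis
    proof (intro exI conjI ballI)
      show "continuous_on UNIV (\<lambda>y. (-1) ^ l * cnj (?Y y))" using Y by (intro continuous_intros)
      show "sph_harmonic n m y = (-1) ^ l * cnj (?Y y)" if "y \<in> sphere 0 1" for y
        unfolding m(1) sph_harmonic_minus[OF m(2)] sph_harmonic_eq_coeff[OF that l] ..
    qed
  next
    case False
    then have "m = int l" by (auto simp: l_def)
    then show ?thesis using sph_harmonic_eq_coeff[OF _ l] Y by blast
  qed
qed

text \<open>For fixed \<open>h\<close> the generating polynomial is the power of a linear form
  \<open>L h\<close>. Its values on the rotated axes again form an isotropic vector, so Laplace's
  integral gives the mean. As this holds for every complex \<open>h\<close>, the coefficients can be
  compared.\<close>

lemma harmonic_gen_mean:
  fixes R :: "real^3 \<Rightarrow> real^3"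
  assumes R: "orthogonal_transformation R" and ts: "t\<^sup>2 + s\<^sup>2 = 1"
  shows "((\<lambda>\<alpha>. coeff (harmonic_gen n (R (vector [s * cos \<alpha>, s * sin \<alpha>, t]))) i)
    has_integral of_real (2 * pi * poly (legendre_poly n) t) * coeff (harmonic_gen n (R (axis 3 1))) i) {0..2 * pi}"
proof -
  have lin: "linear R" using R by (rule orthogonal_transformation_linear)
  define y where "y \<alpha> = R (vector [s * cos \<alpha>, s * sin \<alpha>, t])" for \<alpha>
  define e where "e = (\<lambda>j :: 3. R (axis j 1))"
  have y: "y \<alpha> = t *\<^sub>R e 3 + (s * cos \<alpha>) *\<^sub>R e 1 + (s * sin \<alpha>) *\<^sub>R e 2" for \<alpha>
    unfolding y_def e_def vector3_eq_axis using lin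
    by (simp add: linear_add linear_cmul)
  have "orthogonal_matrix (matrix R)" using R orthogonal_transformation_matrix by blast
  then have MM: "matrix R ** transpose (matrix R) = mat 1" by (simp add: orthogonal_matrix_def)
  \<comment> \<open>Orthonormality of the rows of the matrix, not of its columns \<open>e j\<close>:
    the isotropy condition sums over the three axes.\<close>
  have rows: "e 1 $ i * e 1 $ j + e 2 $ i * e 2 $ j + e 3 $ i * e 3 $ j = (if i = j then 1 else 0)" for i j
    using arg_cong[OF MM, of "\<lambda>M. M $ i $ j"]
    by (simp add: matrix_matrix_mult_def matrix_def transpose_def mat_def sum_3 e_def)
  define L where "L h v = (1 - h\<^sup>2) * of_real (v $ 1) + (- \<i> * (1 + h\<^sup>2)) * of_real (v $ 2) + 2 * h * of_real (v $ 3)"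
    for h and v :: "real^3"
  have poly_gen: "poly (harmonic_gen n v) h = L h v ^ n" for h v
  proof -
    have "azimuth_vec v = of_real (v $ 1) + \<i> * of_real (v $ 2)" "cnj (azimuth_vec v) = of_real (v $ 1) - \<i> * of_real (v $ 2)"
      by (simp_all add: azimuth_vec_def complex_eq_iff)
    then show ?thesis unfolding harmonic_gen_def L_def
      by (simp add: algebra_simps power2_eq_square)
  qed
  have iso: "(L h (e 3))\<^sup>2 + (L h (e 1))\<^sup>2 + (L h (e 2))\<^sup>2 = 0" for h
  proof -
    have r: "complex_of_real (e 1 $ i) * of_real (e 1 $ j) + of_real (e 2 $ i) * of_real (e 2 $ j)
        + of_real (e 3 $ i) * of_real (e 3 $ j) = (if i = j then 1 else 0)" for i j
      unfolding of_real_mult[symmetric] of_real_add[symmetric] rows by simp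
    have expand: "(A * a1 + B * a2 + C * a3)\<^sup>2 + (A * b1 + B * b2 + C * b3)\<^sup>2 + (A * c1 + B * c2 + C * c3)\<^sup>2
      = A\<^sup>2 * (b1 * b1 + c1 * c1 + a1 * a1) + B\<^sup>2 * (b2 * b2 + c2 * c2 + a2 * a2) + C\<^sup>2 * (b3 * b3 + c3 * c3 + a3 * a3)
        + 2 * (A * B) * (b1 * b2 + c1 * c2 + a1 * a2) + 2 * (A * C) * (b1 * b3 + c1 * c3 + a1 * a3)
        + 2 * (B * C) * (b2 * b3 + c2 * c3 + a2 * a3)" for A B C a1 a2 a3 b1 b2 b3 c1 c2 c3 :: complex
      by algebra
    have "(1 - h\<^sup>2)\<^sup>2 + (- \<i> * (1 + h\<^sup>2))\<^sup>2 + (2 * h)\<^sup>2 = 0"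
      by (simp add: power_mult_distrib) algebra
    then show ?thesis
      unfolding L_def expand r by simp
  qed
  have L_add: "L h (u + v) = L h u + L h v" for h u v
    unfolding L_def by (simp add: algebra_simps)
  have L_scale: "L h (r *\<^sub>R v) = of_real r * L h v" for h r v
    unfolding L_def by (simp add: algebra_simps)
  have Ly: "L h (y \<alpha>) = of_real t * L h (e 3) + of_real s * (of_real (cos \<alpha>) * L h (e 1) + of_real (sin \<alpha>) * L h (e 2))" for h \<alpha>
    unfolding y L_add L_scale by (simp add: algebra_simps)
  have cont: "continuous_on {0..2 * pi} (\<lambda>\<alpha>. coeff (harmonic_gen n (y \<alpha>)) i)" for i
    unfolding y by (intro continuous_intros)
  define c where "c i = integral {0..2 * pi} (\<lambda>\<alpha>. coeff (harmonic_gen n (y \<alpha>)) i)" for i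
  have c: "((\<lambda>\<alpha>. coeff (harmonic_gen n (y \<alpha>)) i) has_integral c i) {0..2 * pi}" for i
    unfolding c_def by (intro integrable_integral integrable_continuous_interval cont)
  have poly_sum: "poly (harmonic_gen n v) h = (\<Sum>i\<le>2 * n. coeff (harmonic_gen n v) i * h ^ i)" for v h
    using degree_harmonic_gen[of n v] unfolding poly_altdef
    by (intro sum.mono_neutral_left) (auto simp: coeff_eq_0)
  define d where "d i = of_real (2 * pi * poly (legendre_poly n) t) * coeff (harmonic_gen n (e 3)) i" for i
  have "(\<Sum>i\<le>2 * n. c i * h ^ i) = (\<Sum>i\<le>2 * n. d i * h ^ i)" for h
  proof -
    have "((\<lambda>\<alpha>. \<Sum>i\<le>2 * n. coeff (harmonic_gen n (y \<alpha>)) i * h ^ i) has_integral (\<Sum>i\<le>2 * n. c i * h ^ i)) {0..2 * pi}"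
      by (intro has_integral_sum has_integral_mult_left c) simp
    moreover have "((\<lambda>\<alpha>. \<Sum>i\<le>2 * n. coeff (harmonic_gen n (y \<alpha>)) i * h ^ i) has_integral
        of_real (2 * pi * poly (legendre_poly n) t) * poly (harmonic_gen n (e 3)) h) {0..2 * pi}"
      using laplace_integral[OF iso[of h] ts, of n] unfolding poly_sum[symmetric] poly_gen Ly .
    ultimately have "(\<Sum>i\<le>2 * n. c i * h ^ i) = of_real (2 * pi * poly (legendre_poly n) t) * poly (harmonic_gen n (e 3)) h"
      by (rule has_integral_unique)
    also have "\<dots> = (\<Sum>i\<le>2 * n. d i * h ^ i)"
      unfolding poly_sum d_def sum_distrib_left by (simp only: mult.assoc)
    finally show ?thesis .
  qed
  then have cd: "c i = d i" if "i \<le> 2 * n" for i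
    using that polyfun_eq_coeffs[of c "2 * n" d] by blast
  have "c i = d i"
  proof (cases "i \<le> 2 * n")
    case False
    then have "coeff (harmonic_gen n v) i = 0" for v
      using degree_harmonic_gen[of n v] by (intro coeff_eq_0) simp
    then show ?thesis by (simp add: c_def d_def)
  qed (rule cd)
  then show ?thesis using c[of i] unfolding y_def d_def e_def by simp
qed

text \<open>Negative \<open>m\<close> follows by conjugation, since the factor
  \<open>2 * pi * poly (legendre_poly n) t\<close> is real.\<close>

lemma sph_harmonic_mean:
  fixes R :: "real^3 \<Rightarrow> real^3"
  assumes "orthogonal_transformation R" "t\<^sup>2 + s\<^sup>2 = 1" "- int n \<le> m" "m \<le> int n"
  shows "((\<lambda>\<alpha>. sph_harmonic n m (R (vector [s * cos \<alpha>, s * sin \<alpha>, t])))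
    has_integral of_real (2 * pi * poly (legendre_poly n) t) * sph_harmonic n m (R (axis 3 1))) {0..2 * pi}"
proof -
  define l where "l = nat \<bar>m\<bar>"
  have l: "l \<le> n" using assms by (auto simp: l_def)
  have sph: "R v \<in> sphere 0 1" if "norm v = 1" for v
    using that orthogonal_transformation_norm[OF assms(1)] by simp
  have "(norm (vector [s * cos \<alpha>, s * sin \<alpha>, t] :: real^3))\<^sup>2 = 1" for \<alpha>
  proof -
    have "(s * cos \<alpha>)\<^sup>2 + (s * sin \<alpha>)\<^sup>2 + t\<^sup>2 = s\<^sup>2 * ((sin \<alpha>)\<^sup>2 + (cos \<alpha>)\<^sup>2) + t\<^sup>2" by algebra
    then show ?thesis using assms(2) by (simp add: power2_norm_vec3)
  qed
  then have n1: "norm (vector [s * cos \<alpha>, s * sin \<alpha>, t] :: real^3) = 1" for \<alpha>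
    using norm_ge_zero by (simp add: power2_eq_1_iff) (smt (verit) norm_ge_zero)
  have n2: "norm (axis 3 1 :: real^3) = 1" by simp
  have pos: "((\<lambda>\<alpha>. sph_harmonic n (int l) (R (vector [s * cos \<alpha>, s * sin \<alpha>, t])))
    has_integral of_real (2 * pi * poly (legendre_poly n) t) * sph_harmonic n (int l) (R (axis 3 1))) {0..2 * pi}"
    unfolding sph_harmonic_eq_coeff[OF sph[OF n1] l] sph_harmonic_eq_coeff[OF sph[OF n2] l]
    using has_integral_mult_right[OF harmonic_gen_mean[OF assms(1,2), of n "n + l"], of "of_real (sph_harmonic_const n l)"]
    by (simp add: mult_ac)
  show ?thesis
  proof (cases "m < 0")
    case True
    then have m: "m = - int l" "l > 0" by (auto simp: l_def)
    show ?thesis unfolding m(1) sph_harmonic_minus[OF m(2)]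
      using has_integral_mult_right[OF has_integral_cnj[THEN iffD2, OF pos], of "(-1) ^ l"] by (simp add: mult_ac)
  next
    case False
    then have "m = int l" by (auto simp: l_def)
    then show ?thesis using pos by simp
  qed
qed

section \<open>The Neumann--Poincare operator on spherical harmonics\<close>

definition chord_kernel :: "real \<Rightarrow> real \<Rightarrow> complex" where
  "chord_kernel k r = (1 - \<i> * of_real (k * r)) * cis (k * r) / of_real (8 * pi * r)"

text \<open>The factor \<open>2 / r\<close> is split off because the direction of the normal will
  contribute \<open>r / 2\<close>.\<close>

lemma helmholtz_radial_deriv:
  assumes "r \<noteq> 0"
  shows "((\<lambda>r. - exp (\<i> * of_real (k * r)) / of_real (4 * pi * r)) has_vector_derivative
    of_real (2 / r) * chord_kernel k r) (at r)"
proof -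
  have "((\<lambda>z. - exp (\<i> * (of_real k * z)) / (4 * of_real pi * z)) has_field_derivative
    of_real (2 / r) * chord_kernel k r) (at (of_real r))"
    using assms by (auto intro!: derivative_eq_intros simp: chord_kernel_def cis_conv_exp field_simps power2_eq_square)
  from has_vector_derivative_real_field[OF this] show ?thesis by simp
qed

text \<open>For unit vectors the inner product of \<open>x - y\<close> with \<open>x\<close> is half
  the squared distance. This is the geometric reason for the weak singularity: one power of
  \<open>1/r\<close> disappears.\<close>

lemma np_kernel_eq:
  assumes x: "x \<in> sphere 0 1" and y: "y \<in> sphere 0 1" and xy: "x \<noteq> y"
  shows "np_kernel k x y = chord_kernel k (dist x y)"
proof -
  let ?r = "norm (x - y)"
  have r: "?r \<noteq> 0" using xy by simp
  have "((\<lambda>z. z - y) has_derivative (\<lambda>h. h)) (at x)" by (auto intro!: derivative_eq_intros)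
  from diff_chain_at[OF this has_derivative_norm]
  have "((\<lambda>z. norm (z - y)) has_derivative (\<lambda>h. h \<bullet> sgn (x - y))) (at x)"
    using xy by (simp add: o_def)
  from diff_chain_at[OF this helmholtz_radial_deriv[OF r, of k, unfolded has_vector_derivative_def]]
  have "((\<lambda>z. helmholtz_G k (z - y)) has_derivative
      (\<lambda>h. (h \<bullet> sgn (x - y)) *\<^sub>R (of_real (2 / ?r) * chord_kernel k ?r))) (at x)"
    by (simp add: o_def helmholtz_G_def)
  then have "np_kernel k x y = (x \<bullet> sgn (x - y)) *\<^sub>R (of_real (2 / ?r) * chord_kernel k ?r)"
    unfolding np_kernel_def unit_ball_normal_def using frechet_derivative_at by metis
  also have "x \<bullet> sgn (x - y) = ?r / 2"
  proof -
    have "x \<bullet> x = 1" "y \<bullet> y = 1" using x y by (simp_all add: norm_eq_1)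
    then have "?r\<^sup>2 = 2 * ((x - y) \<bullet> x)"
      unfolding power2_norm_eq_inner by (simp add: inner_diff_left inner_diff_right inner_commute)
    then have "(x - y) \<bullet> x = ?r\<^sup>2 / 2" by simp
    moreover have "x \<bullet> sgn (x - y) = (x - y) \<bullet> x / ?r"
      by (simp add: sgn_div_norm inner_commute divide_inverse mult.commute)
    ultimately have "x \<bullet> sgn (x - y) = ?r\<^sup>2 / 2 / ?r" by (simp only:)
    also have "\<dots> = ?r / 2" using r by (simp add: power2_eq_square)
    finally show ?thesis .
  qed
  also have "(?r / 2) *\<^sub>R (of_real (2 / ?r) * chord_kernel k ?r) = chord_kernel k ?r"
    using r by (simp add: scaleR_conv_of_real)
  finally show ?thesis by (simp add: dist_norm)
qed

section \<open>Truncated integrals and their limit\<close>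

lemma integrable_sphere_measure_continuous:
  fixes f :: "real^3 \<Rightarrow> complex"
  assumes K: "compact K" and f: "continuous_on K f"
  shows "set_integrable sphere_measure K f"
proof -
  have m: "(\<lambda>x. indicator K x *\<^sub>R f x) \<in> borel_measurable borel"
    by (rule borel_measurable_continuous_on_indicator) (use K f in \<open>auto intro: borel_closed compact_imp_closed\<close>)
  have "bounded (f ` K)" by (rule compact_imp_bounded[OF compact_continuous_image[OF f K]])
  then obtain B where B: "\<And>x. x \<in> K \<Longrightarrow> norm (f x) \<le> B" unfolding bounded_iff by auto
  show ?thesis unfolding set_integrable_def
    by (rule sphere_measure.integrable_const_bound[of _ "max B 0"])
       (use m B in \<open>auto simp: indicator_def max.coboundedI1\<close>)
qed

text \<open>Places the pole of the coordinates at any chosen point; the azimuth is the inner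
  variable so that circle means can be inserted.\<close>

lemma sphere_integral_rotated:
  fixes f :: "real^3 \<Rightarrow> complex"
  assumes R: "orthogonal_transformation R" and f: "integrable sphere_measure f"
  shows "(\<integral>y. f y \<partial>sphere_measure) =
    (\<integral>\<theta>. \<integral>\<phi>. (indicator ({0..pi} \<times> {0..2 * pi}) (\<theta>, \<phi>) * sin \<theta>) *\<^sub>R f (R (sphere_param (\<theta>, \<phi>))) \<partial>lborel \<partial>lborel)"
proof -
  have "linear R" using R by (rule orthogonal_transformation_linear)
  then have "continuous_on UNIV R"
    by (intro linear_continuous_on) (simp add: linear_conv_bounded_linear[symmetric])
  then have Rm [measurable]: "R \<in> borel_measurable borel" by (rule borel_measurable_continuous_onI)
  have fm [measurable]: "f \<in> borel_measurable borel"
    using borel_measurable_integrable[OF f] by simp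
  let ?d = "\<lambda>p. indicator ({0..pi} \<times> {0..2 * pi}) p * sin (fst p)"
  have gm: "(\<lambda>y. f (R y)) \<in> borel_measurable borel" by measurable
  have gpm: "(\<lambda>p. f (R (sphere_param p))) \<in> borel_measurable lborel" by measurable
  have "integrable (distr sphere_measure borel R) f" using f distr_sphere_measure_orthogonal[OF R] by simp
  then have "integrable sphere_measure (\<lambda>y. f (R y))"
    by (subst (asm) integrable_distr_eq) (auto simp: measurable_cong_sets[OF sets_sphere_measure refl])
  then have "integrable (density lborel (\<lambda>p. ennreal (?d p))) (\<lambda>p. f (R (sphere_param p)))"
    unfolding sphere_measure_alt by (subst (asm) integrable_distr_eq) auto
  then have int: "integrable (lborel \<Otimes>\<^sub>M lborel) (\<lambda>p. ?d p *\<^sub>R f (R (sphere_param p)))"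
    unfolding lborel_prod by (subst (asm) integrable_density) (use sphere_density_nonneg gpm in auto)
  have "(\<integral>y. f y \<partial>sphere_measure) = (\<integral>y. f y \<partial>(distr sphere_measure borel R))"
    using distr_sphere_measure_orthogonal[OF R] by simp
  also have "\<dots> = (\<integral>y. f (R y) \<partial>sphere_measure)"
    by (rule integral_distr) (auto simp: measurable_cong_sets[OF sets_sphere_measure refl])
  also have "\<dots> = (\<integral>p. f (R (sphere_param p)) \<partial>(density lborel (\<lambda>p. ennreal (?d p))))"
    unfolding sphere_measure_alt by (rule integral_distr) auto
  also have "\<dots> = (\<integral>p. ?d p *\<^sub>R f (R (sphere_param p)) \<partial>(lborel \<Otimes>\<^sub>M lborel))"
    unfolding lborel_prod by (rule integral_density) (use sphere_density_nonneg gpm in auto)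
  also have "\<dots> = (\<integral>\<theta>. \<integral>\<phi>. ?d (\<theta>, \<phi>) *\<^sub>R f (R (sphere_param (\<theta>, \<phi>))) \<partial>lborel \<partial>lborel)"
    by (rule lborel_pair.integral_fst'[OF int, symmetric])
  finally show ?thesis by simp
qed

lemma indicator_scaleR_eqI:
  fixes f g :: "'a \<Rightarrow> 'b::real_vector"
  shows "(x \<in> A \<Longrightarrow> f x = g x) \<Longrightarrow> indicator A x *\<^sub>R f x = (indicator A x :: real) *\<^sub>R g x"
  by (cases "x \<in> A") auto

text \<open>With the pole at \<open>x\<close> the kernel is constant on circles of latitude and the
  excised ball is a polar cap, so the azimuthal integral is a circle mean and what remains is an
  integral over the chord length.\<close>

lemma truncated_np_integral:
  fixes x :: "real^3"
  assumes x: "x \<in> sphere 0 1" and m: "- int n \<le> m" "m \<le> int n" and \<epsilon>: "0 < \<epsilon>"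
  shows "set_integrable sphere_measure (sphere 0 1 - ball x \<epsilon>) (\<lambda>y. np_kernel k x y * sph_harmonic n m y)"
    and "\<epsilon> < 2 \<Longrightarrow> set_lebesgue_integral sphere_measure (sphere 0 1 - ball x \<epsilon>) (\<lambda>y. np_kernel k x y * sph_harmonic n m y)
      = integral {\<epsilon>..2} (\<lambda>r. (1 - \<i> * of_real (k * r)) * cis (k * r) * of_real (poly (legendre_poly n) (1 - r\<^sup>2 / 2))) / 4
        * sph_harmonic n m x"
proof -
  obtain Y where Y: "continuous_on UNIV Y" "\<And>y. y \<in> sphere 0 1 \<Longrightarrow> sph_harmonic n m y = Y y"
    using sph_harmonic_continuous[OF m] by blast
  define K where "K = sphere 0 1 - ball x \<epsilon>"
  have K: "compact K" unfolding K_def by (intro compact_diff) auto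
  \<comment> \<open>The kernel formula is valid only off the diagonal; \<open>K\<close> keeps a
    distance from \<open>x\<close>.\<close>
  define F where "F y = chord_kernel k (dist x y) * sph_harmonic n m y" for y
  have F: "np_kernel k x y * sph_harmonic n m y = F y" if "y \<in> K" for y
    unfolding F_def using that \<epsilon> x by (subst np_kernel_eq) (auto simp: K_def)
  have "continuous_on K (\<lambda>y. chord_kernel k (dist x y) * Y y)"
    unfolding chord_kernel_def
    by (intro continuous_intros continuous_on_subset[OF Y(1)]) (use \<epsilon> in \<open>auto simp: K_def\<close>)
  then have "continuous_on K F"
    by (rule continuous_on_cong[THEN iffD1, rotated 2]) (auto simp: F_def K_def Y(2))
  then have int: "set_integrable sphere_measure K F"
    by (rule integrable_sphere_measure_continuous[OF K])
  show "set_integrable sphere_measure (sphere 0 1 - ball x \<epsilon>) (\<lambda>y. np_kernel k x y * sph_harmonic n m y)"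
    using int unfolding K_def[symmetric]
    by (rule set_integrable_cong[THEN iffD1, rotated 3]) (auto simp: F)
  assume \<epsilon>2: "\<epsilon> < 2"
  have nx: "norm x = 1" using x by simp
  obtain R :: "real^3 \<Rightarrow> real^3" where R: "orthogonal_transformation R" "R (axis 3 1) = x"
    using orthogonal_transformation_exists_1[of "axis 3 1 :: real^3" x] nx by auto
  have lin: "linear R" using R(1) by (rule orthogonal_transformation_linear)
  let ?y = "\<lambda>\<theta> \<phi>. R (sphere_param (\<theta>, \<phi>))"
  have sph: "?y \<theta> \<phi> \<in> sphere 0 1" for \<theta> \<phi>
    using orthogonal_transformation_norm[OF R(1)] by simp
  have dist_y: "dist x (?y \<theta> \<phi>) = 2 * sin (\<theta> / 2)" if "\<theta> \<in> {0..pi}" for \<theta> \<phi>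
  proof -
    have "dist x (?y \<theta> \<phi>) = norm (axis 3 1 - sphere_param (\<theta>, \<phi>))"
      unfolding dist_norm R(2)[symmetric] linear_diff[OF lin, symmetric] orthogonal_transformation_norm[OF R(1)] ..
    moreover have "(norm (axis 3 1 - sphere_param (\<theta>, \<phi>)))\<^sup>2 = (2 * sin (\<theta> / 2))\<^sup>2"
    proof -
      have "(norm (axis 3 1 - sphere_param (\<theta>, \<phi>)))\<^sup>2 = (sin \<theta> * cos \<phi>)\<^sup>2 + (sin \<theta> * sin \<phi>)\<^sup>2 + (1 - cos \<theta>)\<^sup>2"
        unfolding power2_norm_vec3 by (simp add: sphere_param_def axis_def)
      also have "\<dots> = (sin \<theta>)\<^sup>2 * ((sin \<phi>)\<^sup>2 + (cos \<phi>)\<^sup>2) + (1 - cos \<theta>)\<^sup>2" by algebra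
      also have "\<dots> = (sin \<theta>)\<^sup>2 * 1 + (1 - cos \<theta>)\<^sup>2" by (simp only: sin_cos_squared_add)
      also have "\<dots> = ((sin \<theta>)\<^sup>2 + (cos \<theta>)\<^sup>2) + 1 - 2 * cos \<theta>" by algebra
      also have "\<dots> = 2 - 2 * cos (2 * (\<theta> / 2))" by (simp only: sin_cos_squared_add) simp
      also have "\<dots> = (2 * sin (\<theta> / 2))\<^sup>2" unfolding cos_double_sin by (simp add: power2_eq_square)
      finally show ?thesis .
    qed
    moreover have "0 \<le> 2 * sin (\<theta> / 2)" using that by (auto intro!: sin_ge_zero)
    ultimately show ?thesis by (metis norm_ge_zero power2_eq_imp_eq)
  qed
  \<comment> \<open>The polar angle of the rim of the cap, where the chord
    \<open>2 sin (\<theta>/2)\<close> equals \<open>\<epsilon>\<close>.\<close>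
  define \<theta>0 where "\<theta>0 = 2 * arcsin (\<epsilon> / 2)"
  have e2: "0 \<le> \<epsilon> / 2" "\<epsilon> / 2 \<le> 1" using \<epsilon> \<epsilon>2 by auto
  have \<theta>0: "0 < \<theta>0" "\<theta>0 \<le> pi" "2 * sin (\<theta>0 / 2) = \<epsilon>"
  proof -
    have "arcsin 0 < arcsin (\<epsilon> / 2)" by (rule arcsin_less_arcsin) (use e2 \<epsilon> in auto)
    then show "0 < \<theta>0" by (simp add: \<theta>0_def)
    have "arcsin (\<epsilon> / 2) \<le> pi / 2" by (rule arcsin_ubound) (use e2 in auto)
    then show "\<theta>0 \<le> pi" by (simp add: \<theta>0_def)
    have "sin (arcsin (\<epsilon> / 2)) = \<epsilon> / 2" by (rule sin_arcsin) (use e2 in auto)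
    then show "2 * sin (\<theta>0 / 2) = \<epsilon>" by (simp add: \<theta>0_def)
  qed
  have K_iff: "?y \<theta> \<phi> \<in> K \<longleftrightarrow> \<theta>0 \<le> \<theta>" if "\<theta> \<in> {0..pi}" for \<theta> \<phi>
  proof -
    have "?y \<theta> \<phi> \<in> K \<longleftrightarrow> \<epsilon> \<le> 2 * sin (\<theta> / 2)"
      using sph[of \<theta> \<phi>] dist_y[OF that, of \<phi>] by (auto simp: K_def)
    also have "\<dots> \<longleftrightarrow> sin (\<theta>0 / 2) \<le> sin (\<theta> / 2)" using \<theta>0 by auto
    also have "\<dots> \<longleftrightarrow> \<theta>0 / 2 \<le> \<theta> / 2"
      by (rule sin_mono_le_eq) (use that \<theta>0 in auto)
    finally show ?thesis by simp
  qed
  define g where "g = (\<lambda>r. (1 - \<i> * of_real (k * r)) * cis (k * r) * of_real (poly (legendre_poly n) (1 - r\<^sup>2 / 2)))"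
  have g: "continuous_on S g" for S
    unfolding g_def by (intro continuous_intros) auto
  have param: "sphere_param (\<theta>, \<phi>) = vector [sin \<theta> * cos \<phi>, sin \<theta> * sin \<phi>, cos \<theta>]" for \<theta> \<phi>
    by (simp add: sphere_param_def)
  have Yint: "(LINT \<phi>:{0..2 * pi}|lborel. sph_harmonic n m (?y \<theta> \<phi>)) = of_real (2 * pi * poly (legendre_poly n) (cos \<theta>)) * sph_harmonic n m x" for \<theta>
  proof -
    have "continuous_on {0..2 * pi} (\<lambda>\<phi>. Y (?y \<theta> \<phi>))"
      unfolding param vector3_eq_axis
      by (intro continuous_on_compose2[OF Y(1)] continuous_on_compose2[OF linear_continuous_on[of R UNIV]] continuous_intros)
         (auto simp: lin linear_conv_bounded_linear[symmetric])
    then have "continuous_on {0..2 * pi} (\<lambda>\<phi>. sph_harmonic n m (?y \<theta> \<phi>))"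
      using Y(2)[OF sph] by simp
    then have "(LINT \<phi>:{0..2 * pi}|lborel. sph_harmonic n m (?y \<theta> \<phi>)) = integral {0..2 * pi} (\<lambda>\<phi>. sph_harmonic n m (?y \<theta> \<phi>))"
      by (intro set_borel_integral_eq_integral borel_integrable_atLeastAtMost')
    then show ?thesis
      using integral_unique[OF sph_harmonic_mean[OF R(1) _ m, of "cos \<theta>" "sin \<theta>"]] R(2) by (simp add: param)
  qed
  have inner: "(\<integral>\<phi>. (indicator ({0..pi} \<times> {0..2 * pi}) (\<theta>, \<phi>) * sin \<theta>) *\<^sub>R (indicator K (?y \<theta> \<phi>) *\<^sub>R F (?y \<theta> \<phi>)) \<partial>lborel)
     = indicator {\<theta>0..pi} \<theta> *\<^sub>R (cos (\<theta> / 2) *\<^sub>R g (2 * sin (\<theta> / 2)) / 4 * sph_harmonic n m x)" for \<theta>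
  proof (cases "\<theta> \<in> {\<theta>0..pi}")
    case True
    then have \<theta>: "\<theta> \<in> {0..pi}" and K1: "?y \<theta> \<phi> \<in> K" for \<phi> using \<theta>0 K_iff by auto
    let ?c = "of_real (sin \<theta>) * chord_kernel k (2 * sin (\<theta> / 2))"
    have "(\<integral>\<phi>. (indicator ({0..pi} \<times> {0..2 * pi}) (\<theta>, \<phi>) * sin \<theta>) *\<^sub>R (indicator K (?y \<theta> \<phi>) *\<^sub>R F (?y \<theta> \<phi>)) \<partial>lborel)
      = (\<integral>\<phi>. ?c * (indicator {0..2 * pi} \<phi> *\<^sub>R sph_harmonic n m (?y \<theta> \<phi>)) \<partial>lborel)"
      by (intro Bochner_Integration.integral_cong refl)
         (use \<theta> in \<open>simp add: F_def dist_y[OF \<theta>] K1 indicator_def scaleR_conv_of_real\<close>)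
    also have "\<dots> = ?c * (of_real (2 * pi * poly (legendre_poly n) (cos \<theta>)) * sph_harmonic n m x)"
      using Yint[of \<theta>] unfolding set_lebesgue_integral_def by (simp only: integral_mult_right_zero)
    also have "\<dots> = cos (\<theta> / 2) *\<^sub>R g (2 * sin (\<theta> / 2)) / 4 * sph_harmonic n m x"
    proof -
      have "0 < \<theta> / 2" "\<theta> / 2 < pi" using True \<theta>0 by auto
      then have s: "sin (\<theta> / 2) > 0" by (rule sin_gt_zero)
      have "sin \<theta> = 2 * sin (\<theta> / 2) * cos (\<theta> / 2)" using sin_double[of "\<theta> / 2"] by simp
      \<comment> \<open>Area element times circle length over the denominator of the kernel. The
        surviving cosine is the derivative of the chord length in \<theta>, ready for the
        substitution.\<close>
      then have sc: "sin \<theta> * (2 * pi) / (8 * pi * (2 * sin (\<theta> / 2))) = cos (\<theta> / 2) / 4"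
        using s by simp
      have ct: "cos \<theta> = 1 - (2 * sin (\<theta> / 2))\<^sup>2 / 2" using cos_double_sin[of "\<theta> / 2"] by (simp add: power2_eq_square)
      have rearrange: "of_real a * (u / of_real b) * (of_real (c * p) * Z) = of_real (a * c / b) * (u * of_real p) * Z"
        for a b c p :: real and u Z :: complex by simp
      show ?thesis
        unfolding chord_kernel_def g_def ct rearrange sc by (simp add: scaleR_conv_of_real)
    qed
    finally show ?thesis using True by simp
  next
    case False
    then have z: "(indicator ({0..pi} \<times> {0..2 * pi}) (\<theta>, \<phi>) * sin \<theta>) *\<^sub>R (indicator K (?y \<theta> \<phi>) *\<^sub>R F (?y \<theta> \<phi>)) = 0" for \<phi>
      using K_iff[of \<theta> \<phi>] by (auto simp: indicator_def)
    show ?thesis unfolding z using False by simp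
  qed
  have "set_lebesgue_integral sphere_measure (sphere 0 1 - ball x \<epsilon>) (\<lambda>y. np_kernel k x y * sph_harmonic n m y)
    = (\<integral>y. indicator K y *\<^sub>R F y \<partial>sphere_measure)"
    unfolding K_def[symmetric] set_lebesgue_integral_def
    by (rule Bochner_Integration.integral_cong[OF refl], rule indicator_scaleR_eqI) (rule F)
  also have "\<dots> = (\<integral>\<theta>. indicator {\<theta>0..pi} \<theta> *\<^sub>R (cos (\<theta> / 2) *\<^sub>R g (2 * sin (\<theta> / 2)) / 4 * sph_harmonic n m x) \<partial>lborel)"
    unfolding sphere_integral_rotated[OF R(1) int[unfolded set_integrable_def]] inner ..
  also have "\<dots> = (LINT \<theta>:{\<theta>0..pi}|lborel. cos (\<theta> / 2) *\<^sub>R g (2 * sin (\<theta> / 2)) / 4 * sph_harmonic n m x)"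
    unfolding set_lebesgue_integral_def ..
  also have "\<dots> = integral {\<theta>0..pi} (\<lambda>\<theta>. cos (\<theta> / 2) *\<^sub>R g (2 * sin (\<theta> / 2)) / 4 * sph_harmonic n m x)"
  proof (rule set_borel_integral_eq_integral(2), rule borel_integrable_atLeastAtMost')
    have "continuous_on {\<theta>0..pi} (\<lambda>\<theta>. g (2 * sin (\<theta> / 2)))"
      by (rule continuous_on_compose2[OF g[of UNIV]]) (intro continuous_intros, auto)
    then show "continuous_on {\<theta>0..pi} (\<lambda>\<theta>. cos (\<theta> / 2) *\<^sub>R g (2 * sin (\<theta> / 2)) / 4 * sph_harmonic n m x)"
      by (intro continuous_intros) auto
  qed
  also have "\<dots> = integral {\<epsilon>..2} g / 4 * sph_harmonic n m x"
  proof (rule integral_unique)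
    have "((\<lambda>\<theta>. cos (\<theta> / 2) *\<^sub>R g (2 * sin (\<theta> / 2))) has_integral integral {2 * sin (\<theta>0 / 2)..2 * sin (pi / 2)} g) {\<theta>0..pi}"
    \<comment> \<open>A crude interval containing every value of the chord; \<open>g\<close> is
      continuous everywhere.\<close>
    proof (rule has_integral_substitution[where c = "-2" and d = 2])
      show "2 * sin (\<theta>0 / 2) \<le> 2 * sin (pi / 2)" unfolding \<theta>0(3) using \<epsilon>2 by simp
      show "((\<lambda>\<theta>. 2 * sin (\<theta> / 2)) has_field_derivative cos (\<theta> / 2)) (at \<theta> within {\<theta>0..pi})" for \<theta>
        by (auto intro!: derivative_eq_intros)
      show "(\<lambda>\<theta>. 2 * sin (\<theta> / 2)) ` {\<theta>0..pi} \<subseteq> {-2..2}"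
        using sin_le_one sin_ge_minus_one by auto
    qed (use \<theta>0 g in auto)
    then have "((\<lambda>\<theta>. cos (\<theta> / 2) *\<^sub>R g (2 * sin (\<theta> / 2))) has_integral integral {\<epsilon>..2} g) {\<theta>0..pi}"
      unfolding \<theta>0(3) by simp
    then show "((\<lambda>\<theta>. cos (\<theta> / 2) *\<^sub>R g (2 * sin (\<theta> / 2)) / 4 * sph_harmonic n m x) has_integral
        integral {\<epsilon>..2} g / 4 * sph_harmonic n m x) {\<theta>0..pi}"
      by (intro has_integral_mult_left has_integral_divide)
  qed
  finally show "set_lebesgue_integral sphere_measure (sphere 0 1 - ball x \<epsilon>) (\<lambda>y. np_kernel k x y * sph_harmonic n m y)
      = integral {\<epsilon>..2} (\<lambda>r. (1 - \<i> * of_real (k * r)) * cis (k * r) * of_real (poly (legendre_poly n) (1 - r\<^sup>2 / 2))) / 4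
        * sph_harmonic n m x"
    unfolding g_def .
qed

text \<open>The integrand in \<open>r\<close> is continuous down to 0, so the truncated integrals
  depend continuously on the lower limit. Uniqueness of limits justifies the definite description in
  \<open>sphere_pv\<close>.\<close>

lemma np_operator_sph_harmonic:
  fixes x :: "real^3" and k :: real
  assumes x: "x \<in> sphere 0 1" and m: "- int n \<le> m" "m \<le> int n"
  defines "I \<equiv> integral {0..2} (\<lambda>r. (1 - \<i> * of_real (k * r)) * cis (k * r) * of_real (poly (legendre_poly n) (1 - r\<^sup>2 / 2))) / 4"
  shows "np_defined_at k (sph_harmonic n m) x" and "np_operator k (sph_harmonic n m) x = I * sph_harmonic n m x"
proof -
  define g where "g = (\<lambda>r. (1 - \<i> * of_real (k * r)) * cis (k * r) * of_real (poly (legendre_poly n) (1 - r\<^sup>2 / 2)))"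
  have g: "continuous_on {0..2} g"
    unfolding g_def by (intro continuous_intros) auto
  have "continuous_on {0..2} (\<lambda>\<epsilon>. integral {\<epsilon>..2} g)"
    by (rule indefinite_integral_continuous_1') (intro integrable_continuous_interval g)
  then have "((\<lambda>\<epsilon>. integral {\<epsilon>..2} g) \<longlongrightarrow> integral {0..2} g) (at 0 within {0..2})"
    by (auto simp: continuous_on_def)
  then have "((\<lambda>\<epsilon>. integral {\<epsilon>..2} g) \<longlongrightarrow> integral {0..2} g) (at_right 0)"
    by (simp add: at_within_Icc_at_right)
  then have lim: "((\<lambda>\<epsilon>. integral {\<epsilon>..2} g / 4 * sph_harmonic n m x) \<longlongrightarrow> I * sph_harmonic n m x) (at_right 0)"
    unfolding I_def g_def by (intro tendsto_intros) auto
  have "\<forall>\<^sub>F \<epsilon> in at_right 0. integral {\<epsilon>..2} g / 4 * sph_harmonic n m x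
      = set_lebesgue_integral sphere_measure (sphere 0 1 - ball x \<epsilon>) (\<lambda>y. np_kernel k x y * sph_harmonic n m y)"
    unfolding eventually_at_right_field
    by (rule exI[of _ 2]) (simp add: truncated_np_integral(2)[OF x m] g_def)
  then have pv: "has_sphere_pv (\<lambda>y. np_kernel k x y * sph_harmonic n m y) x (I * sph_harmonic n m x)"
    unfolding has_sphere_pv_def using truncated_np_integral(1)[OF x m] Lim_transform_eventually[OF lim]
    by (intro conjI allI impI) simp_all
  then show "np_defined_at k (sph_harmonic n m) x"
    unfolding np_defined_at_def sphere_pv_exists_def by blast
  have "J = I * sph_harmonic n m x" if "has_sphere_pv (\<lambda>y. np_kernel k x y * sph_harmonic n m y) x J" for J
    using that pv tendsto_unique[OF trivial_limit_at_right_real] unfolding has_sphere_pv_def by blast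
  then show "np_operator k (sph_harmonic n m) x = I * sph_harmonic n m x"
    unfolding np_operator_def sphere_pv_def using pv by blast
qed

theorem lemma2p3:
  fixes k :: real and n :: nat and m :: int
  assumes "k > 0" and "- int n \<le> m" and "m \<le> int n"
  shows "\<forall>x \<in> sphere 0 1.
    np_defined_at k (sph_harmonic n m) x \<and>
    np_operator k (sph_harmonic n m) x =
      (- 1 / 2 - \<i> * complex_of_real (k\<^sup>2 * sph_bessel_j n k)
                 * vector_derivative (sph_hankel1 n) (at k)) * sph_harmonic n m x \<and>
    np_operator k (sph_harmonic n m) x =
      (1 / 2 - \<i> * complex_of_real (k\<^sup>2 * deriv (sph_bessel_j n) k)
               * sph_hankel1 n k) * sph_harmonic n m x"
proof (intro ballI conjI)
  fix x :: "real^3" assume x: "x \<in> sphere 0 1"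
  note np = np_operator_sph_harmonic[OF x assms(2,3)]
  show "np_defined_at k (sph_harmonic n m) x" by (rule np)
  show "np_operator k (sph_harmonic n m) x =
      (- 1 / 2 - \<i> * complex_of_real (k\<^sup>2 * sph_bessel_j n k)
                 * vector_derivative (sph_hankel1 n) (at k)) * sph_harmonic n m x"
    unfolding np np_eigenvalue(1)[OF assms(1)] ..
  show "np_operator k (sph_harmonic n m) x =
      (1 / 2 - \<i> * complex_of_real (k\<^sup>2 * deriv (sph_bessel_j n) k)
               * sph_hankel1 n k) * sph_harmonic n m x"
    unfolding np np_eigenvalue(2)[OF assms(1)] ..
qed

end
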